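(* Let $d\geq 2$ be a fixed integer and let $P$ be a set of $n$ points in $\mathbb{R}^d$. Then there is a balanced separator $\sigma$ for $P$ such that, for integers $i$, \[ |P_i(\sigma)| = \begin{cases} O\big((3/2)^i n^{1-1/d}\big) & \text{for all } i<0,\\ O\big(4^i n^{1-1/d}\big) & \text{for all } i\geq 0.\end{cases} \] Moreover, such a separator can be found in $O(n^{d+1})$ time.
   Context: A separator is the boundary of an axis-aligned hypercube in $\mathbb{R}^d$. A separator $\sigma$ partitions $\mathbb{R}^d$ into the region $\sigma_{\mathrm{in}}$ of all points inside or on $\sigma$ and the region $\sigma_{\mathrm{out}}$ of all points strictly outside $\sigma$. The size $\mathrm{size}(\sigma)$ is the side length of the hypercube. With $\delta=4^d/(4^d+1)$, a separator $\sigma$ is balanced for a set $P$ of $n$ points if $\max(|P\cap\sigma_{\mathrm{in}}|,|P\cap\sigma_{\mathrm{out}}|)\leq \delta n$. The relative distance from a point $p$ to $\sigma$ is $\mathrm{rdist}(p,\sigma)=d_\infty(p,\sigma)/\mathrm{size}(\sigma)$, where $d_\infty(p,\sigma)$ is the shortest $\ell_\infty$-distance between $p$ and any point on $\sigma$. For an integer $i$ (possibly negative), $P_i(\sigma)=\{p\in P \mid \mathrm{rdist}(p,\sigma)\leq 2^i/n^{1/d}\}$. The dimension $d$ is considered an absolute constant, so the constants hidden in the $O$-notation may depend on $d$ (but not on $P$, $n$ or $i$). The model of computation is the real-RAM with square roots.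
   Formalization: The set P is assumed to have at least two points: for n = 1 no balanced separator exists, since one side contains the only point and δ < 1, and for n = 0 the bound 2^i/n^{1/d} in the definition of P_i is undefined. *)

theory Defs
  imports "HOL-Analysis.Analysis" "HOL-Library.Landau_Symbols"
begin

section \<open>Separators\<close>

text \<open>
  A separator is the boundary of a non-degenerate axis-aligned hypercube. It is represented by
  the corner of the hypercube that is smallest in every coordinate, and the side length; the
  latter is required to be positive by \<open>is_separator\<close>.
\<close>

type_synonym 'd separator = "(real ^ 'd) \<times> real"

definition sep_size :: "'d separator \<Rightarrow> real" where
  "sep_size \<sigma> = snd \<sigma>"

definition is_separator :: "'d separator \<Rightarrow> bool" where
  "is_separator \<sigma> \<longleftrightarrow> sep_size \<sigma> > 0"

definition sep_in :: "'d::finite separator \<Rightarrow> (real ^ 'd) set" where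
  "sep_in \<sigma> = cbox (fst \<sigma>) (\<chi> k. fst \<sigma> $ k + sep_size \<sigma>)"

definition sep_out :: "'d::finite separator \<Rightarrow> (real ^ 'd) set" where
  "sep_out \<sigma> = - sep_in \<sigma>"

definition sep_boundary :: "'d::finite separator \<Rightarrow> (real ^ 'd) set" where
  "sep_boundary \<sigma> = frontier (sep_in \<sigma>)"

text \<open>
  If \<open>card P = 1\<close>, no separator is balanced, since one side contains the only point and the bound
  is less than \<open>1\<close>.
\<close>

definition balanced :: "(real ^ 'd::finite) set \<Rightarrow> 'd separator \<Rightarrow> bool" where
  "balanced P \<sigma> \<longleftrightarrow>
     real (max (card (P \<inter> sep_in \<sigma>)) (card (P \<inter> sep_out \<sigma>)))
       \<le> (4 ^ CARD('d) / (4 ^ CARD('d) + 1)) * real (card P)"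

definition dist_inf :: "real ^ 'd::finite \<Rightarrow> 'd separator \<Rightarrow> real" where
  "dist_inf p \<sigma> = (INF q\<in>sep_boundary \<sigma>. infnorm (p - q))"

definition rdist :: "real ^ 'd::finite \<Rightarrow> 'd separator \<Rightarrow> real" where
  "rdist p \<sigma> = dist_inf p \<sigma> / sep_size \<sigma>"

definition near :: "(real ^ 'd::finite) set \<Rightarrow> int \<Rightarrow> 'd separator \<Rightarrow> (real ^ 'd) set" where
  "near P i \<sigma> = {p \<in> P. rdist p \<sigma> \<le> 2 powi i / real (card P) powr (1 / real CARD('d))}"

definition good_separator :: "real \<Rightarrow> (real ^ 'd::finite) set \<Rightarrow> 'd separator \<Rightarrow> bool" where
  "good_separator C P \<sigma> \<longleftrightarrow>
     is_separator \<sigma> \<and> balanced P \<sigma> \<and>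
     (\<forall>i<0. real (card (near P i \<sigma>))
        \<le> C * ((3 / 2) powi i * real (card P) powr (1 - 1 / real CARD('d)))) \<and>
     (\<forall>i\<ge>0. real (card (near P i \<sigma>))
        \<le> C * (4 powi i * real (card P) powr (1 - 1 / real CARD('d))))"


section \<open>The real-RAM with square roots\<close>

text \<open>
  A machine has two unbounded memories, one of natural numbers and one of reals, both addressed
  by natural numbers (indirect addressing: an address may be computed). Naturals support
  addition, truncated subtraction and comparison; reals support the four arithmetic operations,
  square root and comparison. Naturals can be cast to reals, but there is no cast (or floor) in
  the other direction, there are no real constants besides those arising from natural ones, and
  there is no unit-cost multiplication of naturals, so the usual ways of cheating in unit-cost
  models are excluded. Programs are structured instead of having jumps; this changes running times
  by at most a constant factor depending on the program. Every memory access, operation,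
  comparison, constant, store and branch costs one step.

  Division by zero and the square root of a negative number do not abort but have the values
  given by the HOL library (\<open>x / 0 = 0\<close> and \<open>sqrt (- x) = - sqrt x\<close>);
  this could be simulated by tests at constant cost.
\<close>

record mem =
  nmem :: "nat \<Rightarrow> nat"
  rmem :: "nat \<Rightarrow> real"

datatype nexp =
    NConst nat
  | NLoad nexp
  | NAdd nexp nexp
  | NSub nexp nexp

datatype rexp =
    RCast nexp
  | RLoad nexp
  | RAdd rexp rexp
  | RSub rexp rexp
  | RMul rexp rexp
  | RDiv rexp rexp
  | RSqrt rexp

datatype bexp =
    NLess nexp nexp
  | RLess rexp rexp
  | BNot bexp
  | BAnd bexp bexp

datatype com =
    Skip
  | NStore nexp nexp  \<comment> \<open>address, value\<close>
  | RStore nexp rexp  \<comment> \<open>address, value\<close>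
  | Seq com com
  | Cond bexp com com
  | While bexp com

fun nval :: "nexp \<Rightarrow> mem \<Rightarrow> nat" where
  "nval (NConst k) m = k"
| "nval (NLoad a) m = nmem m (nval a m)"
| "nval (NAdd a b) m = nval a m + nval b m"
| "nval (NSub a b) m = nval a m - nval b m"

fun rval :: "rexp \<Rightarrow> mem \<Rightarrow> real" where
  "rval (RCast a) m = real (nval a m)"
| "rval (RLoad a) m = rmem m (nval a m)"
| "rval (RAdd a b) m = rval a m + rval b m"
| "rval (RSub a b) m = rval a m - rval b m"
| "rval (RMul a b) m = rval a m * rval b m"
| "rval (RDiv a b) m = rval a m / rval b m"
| "rval (RSqrt a) m = sqrt (rval a m)"

fun bval :: "bexp \<Rightarrow> mem \<Rightarrow> bool" where
  "bval (NLess a b) m \<longleftrightarrow> nval a m < nval b m"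
| "bval (RLess a b) m \<longleftrightarrow> rval a m < rval b m"
| "bval (BNot a) m \<longleftrightarrow> \<not> bval a m"
| "bval (BAnd a b) m \<longleftrightarrow> bval a m \<and> bval b m"

fun ncost :: "nexp \<Rightarrow> nat" where
  "ncost (NConst k) = 1"
| "ncost (NLoad a) = 1 + ncost a"
| "ncost (NAdd a b) = 1 + ncost a + ncost b"
| "ncost (NSub a b) = 1 + ncost a + ncost b"

fun rcost :: "rexp \<Rightarrow> nat" where
  "rcost (RCast a) = 1 + ncost a"
| "rcost (RLoad a) = 1 + ncost a"
| "rcost (RAdd a b) = 1 + rcost a + rcost b"
| "rcost (RSub a b) = 1 + rcost a + rcost b"
| "rcost (RMul a b) = 1 + rcost a + rcost b"
| "rcost (RDiv a b) = 1 + rcost a + rcost b"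
| "rcost (RSqrt a) = 1 + rcost a"

fun bcost :: "bexp \<Rightarrow> nat" where
  "bcost (NLess a b) = 1 + ncost a + ncost b"
| "bcost (RLess a b) = 1 + rcost a + rcost b"
| "bcost (BNot a) = 1 + bcost a"
| "bcost (BAnd a b) = 1 + bcost a + bcost b"

text \<open>
  \<open>exec c m t m'\<close>: started in memory \<open>m\<close>, program \<open>c\<close> halts after exactly \<open>t\<close> steps in
  memory \<open>m'\<close>.
\<close>

inductive exec :: "com \<Rightarrow> mem \<Rightarrow> nat \<Rightarrow> mem \<Rightarrow> bool" where
  Skip: "exec Skip m 1 m"
| NStore: "exec (NStore a e) m (1 + ncost a + ncost e)
             (m\<lparr>nmem := (nmem m)(nval a m := nval e m)\<rparr>)"
| RStore: "exec (RStore a e) m (1 + ncost a + rcost e)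
             (m\<lparr>rmem := (rmem m)(nval a m := rval e m)\<rparr>)"
| Seq: "exec c1 m1 t1 m2 \<Longrightarrow> exec c2 m2 t2 m3 \<Longrightarrow> exec (Seq c1 c2) m1 (t1 + t2) m3"
| CondTrue: "bval b m \<Longrightarrow> exec c1 m t m' \<Longrightarrow> exec (Cond b c1 c2) m (1 + bcost b + t) m'"
| CondFalse: "\<not> bval b m \<Longrightarrow> exec c2 m t m' \<Longrightarrow> exec (Cond b c1 c2) m (1 + bcost b + t) m'"
| WhileFalse: "\<not> bval b m \<Longrightarrow> exec (While b c) m (1 + bcost b) m"
| WhileTrue: "bval b m1 \<Longrightarrow> exec c m1 t1 m2 \<Longrightarrow> exec (While b c) m2 t2 m3 \<Longrightarrow>
                exec (While b c) m1 (1 + bcost b + t1 + t2) m3"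

inductive_cases exec_SkipE: "exec Skip m t m'"
inductive_cases exec_NStoreE: "exec (NStore a e) m t m'"
inductive_cases exec_RStoreE: "exec (RStore a e) m t m'"
inductive_cases exec_SeqE: "exec (Seq c1 c2) m t m'"
inductive_cases exec_CondE: "exec (Cond b c1 c2) m t m'"
inductive_cases exec_WhileE: "exec (While b c) m t m'"

lemma exec_deterministic:
  "exec c m t m' \<Longrightarrow> exec c m u m'' \<Longrightarrow> u = t \<and> m'' = m'"
proof (induction arbitrary: u m'' rule: exec.induct)
  case Skip
  then show ?case by (auto elim: exec_SkipE)
next
  case NStore
  then show ?case by (auto elim: exec_NStoreE)
next
  case RStore
  then show ?case by (auto elim: exec_RStoreE)
next
  case Seq
  from Seq.prems show ?case by (auto elim!: exec_SeqE dest!: Seq.IH)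
next
  case CondTrue
  from CondTrue.prems CondTrue.hyps show ?case by (auto elim!: exec_CondE dest!: CondTrue.IH)
next
  case CondFalse
  from CondFalse.prems CondFalse.hyps show ?case by (auto elim!: exec_CondE dest!: CondFalse.IH)
next
  case (WhileFalse b m c)
  from WhileFalse.prems WhileFalse.hyps show ?case by (cases rule: exec_WhileE) auto
next
  case (WhileTrue b m1 c t1 m2 t2 m3)
  show ?case
    by (rule exec_WhileE[OF WhileTrue.prems])
       (use WhileTrue.hyps(1) WhileTrue.IH in \<open>auto dest!: WhileTrue.IH(1)\<close>)
qed


section \<open>Input and output\<close>

text \<open>
  The coordinates of \<open>\<real>\<^sup>d\<close> are indexed by the finite type \<open>'d\<close>; \<open>e\<close> lists them as
  \<open>e 0, \<dots>, e (d - 1)\<close>. The input is the number of points in cell \<open>0\<close> of the natural memory,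
  and the points, one after the other, in the real memory; all other cells are \<open>0\<close>. The
  output is expected in the real memory: the corner in cells \<open>0, \<dots>, d - 1\<close> and the side
  length in cell \<open>d\<close>.
\<close>

definition input_mem :: "(nat \<Rightarrow> 'd::finite) \<Rightarrow> (real ^ 'd) list \<Rightarrow> mem" where
  "input_mem e ps =
     \<lparr>nmem = (\<lambda>j. if j = 0 then length ps else 0),
      rmem = (\<lambda>j. if j < length ps * CARD('d)
                  then (ps ! (j div CARD('d))) $ e (j mod CARD('d)) else 0)\<rparr>"

definition output_sep :: "(nat \<Rightarrow> 'd::finite) \<Rightarrow> mem \<Rightarrow> 'd separator" where
  "output_sep e m =
     ((\<chi> k. rmem m (the_inv_into {..<CARD('d)} e k)), rmem m CARD('d))"

text \<open>
  Given any finite set of at least two points, in any order, \<open>c\<close> halts within \<open>T n\<close> steps and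
  outputs a separator that is good with constant \<open>C\<close>.
\<close>

definition finds_good_separator ::
  "'d::finite itself \<Rightarrow> real \<Rightarrow> com \<Rightarrow> (nat \<Rightarrow> nat) \<Rightarrow> bool" where
  "finds_good_separator _ C c T \<longleftrightarrow>
     (\<forall>(e :: nat \<Rightarrow> 'd) ps.
        bij_betw e {..<CARD('d)} UNIV \<longrightarrow> distinct ps \<longrightarrow> length ps \<ge> 2 \<longrightarrow>
        (\<exists>t m. exec c (input_mem e ps) t m \<and> t \<le> T (length ps) \<and>
               good_separator C (set ps) (output_sep e m)))"

end

theory Submission imports Defs begin

text \<open>
  All candidate separators are cubes centred at a single input point. Call a cube crowded if it
  contains at least \<open>n / (4\<^sup>d + 1)\<close> points, and let \<open>r\<close> be the least distance between two distinct
  points \<open>p, q\<close> for which the cube of radius \<open>r\<close> around \<open>p\<close> is crowded. A set of diameter less than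
  \<open>r\<close> with at least two points is not crowded, since otherwise one of its points and the farthest
  other one would give a smaller radius. So for \<open>r \<le> h < 2 * r\<close> the cube of radius \<open>h\<close> around \<open>p\<close>,
  which is covered by \<open>4\<^sup>d\<close> cubes of side \<open>h / 2 < r\<close>, is balanced as soon as \<open>n > 4\<^sup>d + 1\<close>.

  The radius is then chosen by averaging. With \<open>N = \<lfloor>n\<^bsup>1/d\<^esup>\<rfloor>\<close>, a point whose scaled
  distance to the separator is \<open>u\<close> is charged \<open>profile (N * u)\<close>, where the profile is decreasing and
  has finite integral. Among \<open>2 * n\<close> equidistant radii at least \<open>n\<close> keep half a grid cell away from
  every point, and over these the average total charge is \<open>O(n / N)\<close>. A radius of least total charge
  satisfies the bounds for all \<open>i\<close> at once, because every point of \<open>P\<^sub>i\<close> is charged at least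
  \<open>profile (4 * 2\<^sup>i)\<close>. If \<open>n \<le> 4\<^sup>d + 1\<close>, then \<open>r\<close> is the distance of a closest pair, and the cube
  of radius \<open>r / 2\<close> around \<open>p\<close> has relative distance at least \<open>1/2\<close> to all points.

  Brute force over \<open>p\<close>, \<open>q\<close> takes time \<open>O(n\<^sup>3)\<close>, and evaluating all total charges \<open>O(n\<^sup>2)\<close>; since
  \<open>d \<ge> 2\<close>, this is within \<open>O(n\<^bsup>d+1\<^esup>)\<close>.
\<close>

section \<open>Cubes in the maximum norm\<close>

lemma infnorm_le_iff:
  fixes x :: "real ^ 'd::finite"
  shows "infnorm x \<le> h \<longleftrightarrow> (\<forall>k. \<bar>x $ k\<bar> \<le> h)"
proof
  assume "infnorm x \<le> h"
  then show "\<forall>k. \<bar>x $ k\<bar> \<le> h"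
    using component_le_infnorm_cart[of x] order_trans by blast
next
  assume "\<forall>k. \<bar>x $ k\<bar> \<le> h"
  then show "infnorm x \<le> h"
    unfolding infnorm_cart by (intro cSup_least) auto
qed

definition centred :: "real ^ 'd::finite \<Rightarrow> real \<Rightarrow> 'd separator" where
  "centred p h = (p - (\<chi> k. h), 2 * h)"

lemma sep_size_centred [simp]: "sep_size (centred p h) = 2 * h"
  by (simp add: centred_def sep_size_def)

lemma sep_in_centred: "sep_in (centred p h) = {q. infnorm (q - p) \<le> h}"
  by (auto simp: sep_in_def centred_def sep_size_def infnorm_le_iff mem_box_cart abs_le_iff algebra_simps)

lemma continuous_on_infnorm_diff: "continuous_on UNIV (\<lambda>q. infnorm (q - p))"
  by (intro continuous_intros)

text \<open>The open cube lies in the interior of the closed one, and the closed cube contains its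
  frontier; this excludes smaller and larger distances from \<open>p\<close>.\<close>

lemma sep_boundary_centred: "sep_boundary (centred p h) \<subseteq> {q. infnorm (q - p) = h}"
proof -
  have "closed {q. infnorm (q - p) \<le> h}"
    by (intro closed_Collect_le continuous_on_infnorm_diff continuous_on_const)
  moreover have "{q. infnorm (q - p) < h} \<subseteq> interior {q. infnorm (q - p) \<le> h}"
    by (intro interior_maximal open_Collect_less continuous_on_infnorm_diff continuous_on_const) auto
  ultimately show ?thesis
    unfolding sep_boundary_def sep_in_centred frontier_def by force
qed

lemma sep_boundary_nonempty:
  assumes "h > 0"
  shows "sep_boundary (centred p h) \<noteq> {}"
proof -
  have "p \<in> sep_in (centred p h)"
    using assms by (simp add: sep_in_centred infnorm_0)
  moreover have "sep_in (centred p h) \<noteq> UNIV"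
  proof
    assume "sep_in (centred p h) = UNIV"
    then have "p + (\<chi> k. 2 * h) \<in> sep_in (centred p h)" by simp
    then show False using assms by (simp add: sep_in_centred infnorm_le_iff)
  qed
  ultimately show ?thesis
    unfolding sep_boundary_def using frontier_eq_empty by blast
qed

text \<open>Reverse triangle inequality against each boundary point. Lower bounds on distances are
  what upper bounds on \<open>near\<close> call for.\<close>

lemma dist_inf_centred_ge:
  assumes "h > 0"
  shows "\<bar>infnorm (x - p) - h\<bar> \<le> dist_inf x (centred p h)"
  unfolding dist_inf_def
proof (rule cINF_greatest[OF sep_boundary_nonempty[OF assms]])
  fix q assume "q \<in> sep_boundary (centred p h)"
  then have "infnorm (q - p) = h" using sep_boundary_centred by blast
  then show "\<bar>infnorm (x - p) - h\<bar> \<le> infnorm (x - q)"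
    using absdiff_infnorm[of "x - p" "q - p"] by simp
qed

section \<open>Covering a cube by cells of a quarter of its side\<close>

text \<open>
  The cube is cut into \<open>4\<^sup>d\<close> closed cells; \<open>min 3\<close> puts the far faces into the last cells.
\<close>

lemma card_cube_le:
  fixes P :: "(real ^ 'd::finite) set"
  assumes "finite P" "0 < h" "h < 2 * r" "0 \<le> m"
    and small: "\<And>T. T \<subseteq> P \<Longrightarrow> (\<And>x y. x \<in> T \<Longrightarrow> y \<in> T \<Longrightarrow> infnorm (x - y) < r) \<Longrightarrow> real (card T) \<le> m"
  shows "real (card {x \<in> P. infnorm (x - p) \<le> h}) \<le> 4 ^ CARD('d) * m"
proof -
  define A where "A = {x \<in> P. infnorm (x - p) \<le> h}"
  define pos where "pos x k = (x $ k - p $ k + h) / (h / 2)" for x :: "real ^ 'd" and k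
  define cell where "cell x = (\<lambda>k. min 3 (nat \<lfloor>pos x k\<rfloor>))" for x
  define F where "F = (UNIV :: 'd set) \<rightarrow>\<^sub>E {..<4::nat}"
  have F: "finite F" "card F = 4 ^ CARD('d)"
    unfolding F_def by (auto intro: finite_PiE simp: card_PiE)
  have fibre: "real (card {x \<in> A. cell x = c}) \<le> m" for c
  proof (rule small)
    show "{x \<in> A. cell x = c} \<subseteq> P" by (auto simp: A_def)
    fix x y assume xy: "x \<in> {x \<in> A. cell x = c}" "y \<in> {x \<in> A. cell x = c}"
    have "\<bar>(x - y) $ k\<bar> \<le> h / 2" for k
    proof -
      have bounds: "0 \<le> pos z k \<and> pos z k \<le> 4" if "z \<in> A" for z
      proof -
        have "\<bar>(z - p) $ k\<bar> \<le> h" using that by (auto simp: A_def infnorm_le_iff)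
        then show ?thesis using \<open>0 < h\<close> by (auto simp: pos_def field_simps)
      qed
      have "cell x k = cell y k" using xy by simp
      \<comment> \<open>An index below 3 means equal floors; index 3 means that both positions lie
        in [3, 4].\<close>
      then have "\<bar>pos x k - pos y k\<bar> \<le> 1"
        using bounds[of x] bounds[of y] xy unfolding cell_def by (simp add: min_def split: if_splits) linarith+
      moreover have "(x - y) $ k = (pos x k - pos y k) * (h / 2)"
        using \<open>0 < h\<close> by (simp add: pos_def field_simps)
      moreover have "\<bar>pos x k - pos y k\<bar> * (h / 2) \<le> 1 * (h / 2)" if "\<bar>pos x k - pos y k\<bar> \<le> 1"
        using that \<open>0 < h\<close> by (intro mult_right_mono) auto
      ultimately show ?thesis
        using \<open>0 < h\<close> by (simp only: abs_mult) simp
    qed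
    then have "infnorm (x - y) \<le> h / 2" unfolding infnorm_le_iff by blast
    then show "infnorm (x - y) < r" using \<open>h < 2 * r\<close> by linarith
  qed
  have "A \<subseteq> (\<Union>c\<in>F. {x \<in> A. cell x = c})"
    by (auto simp: F_def cell_def)
  then have "card A \<le> card (\<Union>c\<in>F. {x \<in> A. cell x = c})"
    using \<open>finite P\<close> F by (intro card_mono) (auto simp: A_def)
  also have "\<dots> \<le> (\<Sum>c\<in>F. card {x \<in> A. cell x = c})"
    by (rule card_UN_le[OF F(1)])
  finally have "real (card A) \<le> real (\<Sum>c\<in>F. card {x \<in> A. cell x = c})"
    by (simp only: of_nat_le_iff)
  then have "real (card A) \<le> (\<Sum>c\<in>F. real (card {x \<in> A. cell x = c}))"
    by (simp only: of_nat_sum)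
  also have "\<dots> \<le> (\<Sum>c\<in>F. m)" by (intro sum_mono fibre)
  finally show ?thesis by (simp add: F A_def)
qed

section \<open>The potential\<close>

text \<open>
  With \<open>v = 4 * 2\<^sup>i\<close>, the reciprocal of the profile is \<open>O(2\<^bsup>3i/4\<^esup>)\<close> for \<open>i < 0\<close>, which is \<open>O((3/2)\<^sup>i)\<close> because
  \<open>2\<^bsup>3/4\<^esup> \<ge> 3/2\<close>, and \<open>O(2\<^bsup>5i/4\<^esup>)\<close>, hence \<open>O(4\<^sup>i)\<close>, for \<open>i \<ge> 0\<close>. At the same time the profile is
  integrable over the positive half-line. Fourth roots are available on the machine.
\<close>

definition profile :: "real \<Rightarrow> real" where
  "profile v = 1 / (sqrt (sqrt v) ^ 3 * (1 + sqrt (sqrt v)) ^ 2)"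

lemma profile_pos: "v > 0 \<Longrightarrow> profile v > 0"
  unfolding profile_def
  by (intro divide_pos_pos mult_pos_pos zero_less_power add_pos_nonneg) auto

lemma profile_nonneg: "v \<ge> 0 \<Longrightarrow> profile v \<ge> 0"
  by (simp add: profile_def)

lemma profile_antimono: "0 < v \<Longrightarrow> v \<le> w \<Longrightarrow> profile w \<le> profile v"
  unfolding profile_def
  by (intro divide_left_mono mult_mono power_mono mult_pos_pos zero_less_power)
     (auto simp: add_pos_pos)

text \<open>
  The profile is, up to a factor of \<open>4\<close>, the derivative of \<open>z / (1 + z)\<close> with \<open>z = root 4 v\<close>, so
  the sum telescopes.
\<close>

lemma sum_profile_le:
  assumes "c > 0"
  shows "(\<Sum>k=1..m. profile (c * real k)) \<le> 4 / c"
proof -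
  define z where "z k = sqrt (sqrt (c * real k))" for k
  define A where "A k = z k / (1 + z k)" for k
  have z0: "z k \<ge> 0" for k using assms by (simp add: z_def)
  have z4: "z k ^ 4 = c * real k" for k
  proof -
    have "z k ^ 4 = ((z k)\<^sup>2)\<^sup>2" by simp
    then show ?thesis using assms by (simp add: z_def)
  qed
  have step: "c * profile (c * real (Suc k)) \<le> 4 * (A (Suc k) - A k)" for k
  proof -
    define s t where "s = z k" and "t = z (Suc k)"
    have st: "0 \<le> s" "s \<le> t" "0 < t"
      using assms by (auto simp: s_def t_def z_def)
    have "t ^ 4 - s ^ 4 = c"
      using z4[of k] z4[of "Suc k"] by (simp add: s_def t_def algebra_simps)
    moreover have "t ^ 4 - s ^ 4 = (t - s) * ((t + s) * (t\<^sup>2 + s\<^sup>2))"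
      by (simp add: algebra_simps power4_eq_xxxx power2_eq_square)
    moreover have "(t + s) * (t\<^sup>2 + s\<^sup>2) \<le> (t + t) * (t\<^sup>2 + t\<^sup>2)"
      using st by (intro mult_mono add_mono power_mono) auto
    moreover have "(t + t) * (t\<^sup>2 + t\<^sup>2) = 4 * t ^ 3"
      by (simp add: power2_eq_square power3_eq_cube)
    ultimately have "c \<le> (t - s) * (4 * t ^ 3)"
      using st by (metis diff_ge_0_iff_ge mult_left_mono)
    then have c: "c / t ^ 3 \<le> 4 * (t - s)"
      using st by (simp add: field_simps)
    have "c * profile (c * real (Suc k)) = c / t ^ 3 / (1 + t)\<^sup>2"
      by (simp add: profile_def t_def z_def)
    also have "\<dots> \<le> 4 * (t - s) / (1 + t)\<^sup>2"
      using c by (intro divide_right_mono) auto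
    \<comment> \<open>Weakening one factor \<open>1 + t\<close> to \<open>1 + s\<close> turns the
      bound into an exact difference of values of \<open>A\<close>.\<close>
    also have "\<dots> \<le> 4 * (t - s) / ((1 + t) * (1 + s))"
      using st by (intro divide_left_mono) (auto simp: power2_eq_square intro!: mult_left_mono)
    also have "\<dots> = 4 * (A (Suc k) - A k)"
      using st by (simp add: A_def flip: s_def t_def) (simp add: field_simps)
    finally show ?thesis .
  qed
  have "c * (\<Sum>k=1..m. profile (c * real k)) = (\<Sum>k<m. c * profile (c * real (Suc k)))"
    by (simp add: sum_distrib_left sum.atLeast1_atMost_eq)
  also have "\<dots> \<le> (\<Sum>k<m. 4 * (A (Suc k) - A k))"
    by (intro sum_mono step)
  also have "\<dots> = 4 * (A m - A 0)"
    by (simp only: sum_lessThan_telescope flip: sum_distrib_left)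
  also have "\<dots> \<le> 4"
    using z0[of m] by (simp add: A_def z_def[of 0] divide_simps)
  finally show ?thesis
    using assms by (simp add: field_simps)
qed

text \<open>By antitonicity each argument may be lowered to its own multiple of \<open>c\<close>;
  injectivity makes the result a partial sum of the telescoping one.\<close>

lemma sum_profile_inj_le:
  assumes "finite J" "c > 0" "inj_on \<phi> J" "\<And>j. j \<in> J \<Longrightarrow> \<phi> j \<ge> 1"
    and "\<And>j. j \<in> J \<Longrightarrow> c * real (\<phi> j) \<le> v j"
  shows "(\<Sum>j\<in>J. profile (v j)) \<le> 4 / c"
proof -
  have "(\<Sum>j\<in>J. profile (v j)) \<le> (\<Sum>j\<in>J. profile (c * real (\<phi> j)))"
    using assms(2,4,5) by (intro sum_mono profile_antimono) (auto simp: Suc_le_eq)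
  also have "\<dots> = (\<Sum>k\<in>\<phi> ` J. profile (c * real k))"
    by (simp add: sum.reindex[OF assms(3)])
  also have "\<dots> \<le> (\<Sum>k=1..Max (\<phi> ` J). profile (c * real k))"
    using assms by (intro sum_mono2) (auto intro!: profile_nonneg)
  also have "\<dots> \<le> 4 / c" by (rule sum_profile_le[OF assms(2)])
  finally show ?thesis .
qed

section \<open>Total charge over equally spaced scaled radii\<close>

definition grid :: "nat \<Rightarrow> nat \<Rightarrow> real" where
  "grid n j = 1 + (2 * real j + 1) / (4 * real n)"

text \<open>The values are the midpoints of the \<open>2 * n\<close> equal cells of [1, 2], hence
  lie strictly inside; half a cell has length \<open>1 / (4 * n)\<close>.\<close>

lemma grid_bounds: "j < 2 * n \<Longrightarrow> 1 < grid n j \<and> grid n j < 2"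
  by (auto simp: grid_def field_simps)

lemma grid_diff: "n > 0 \<Longrightarrow> grid n i - grid n j = (real i - real j) / (2 * real n)"
  by (simp add: grid_def field_simps)

text \<open>On each side of \<open>a\<close>, the nearest index in \<open>J\<close> is at distance
  at least \<open>1 / (4 * n)\<close> by \<open>far\<close>, and each index step adds
  \<open>1 / (2 * n)\<close>. So the index offset plus one serves as the injection, and the two
  sides give \<open>4 / c\<close> each.\<close>

lemma sum_grid_le:
  assumes "n > 0" "N > 0" "J \<subseteq> {..<2 * n}"
    and far: "\<And>j. j \<in> J \<Longrightarrow> \<bar>a - grid n j\<bar> \<ge> 1 / (4 * real n)"
  shows "(\<Sum>j\<in>J. profile (N * \<bar>a - grid n j\<bar>)) \<le> 32 * real n / N"
proof -
  define c where "c = N / (4 * real n)"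
  have c: "c > 0" using assms by (simp add: c_def)
  define J1 where "J1 = {j \<in> J. a \<le> grid n j}"
  define J2 where "J2 = {j \<in> J. \<not> a \<le> grid n j}"
  have fin: "finite J" using assms(3) finite_subset by blast
  then have fin12: "finite J1" "finite J2" by (auto simp: J1_def J2_def)
  have "(\<Sum>j\<in>J1. profile (N * \<bar>a - grid n j\<bar>)) \<le> 4 / c"
  proof (rule sum_profile_inj_le[OF fin12(1) c])
    fix j assume j: "j \<in> J1"
    then have m: "Min J1 \<in> J1" "Min J1 \<le> j"
      using fin12 by (auto intro: Min_in)
    have "grid n j - a = (grid n j - grid n (Min J1)) + (grid n (Min J1) - a)" by simp
    also have "\<dots> \<ge> (real j - real (Min J1)) / (2 * real n) + 1 / (4 * real n)"
      using far[of "Min J1"] m assms(1) by (simp add: grid_diff J1_def)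
    finally have "real (j - Min J1 + 1) / (4 * real n) \<le> grid n j - a"
      using m assms(1) by (simp add: of_nat_diff field_simps)
    then have "N * (real (j - Min J1 + 1) / (4 * real n)) \<le> N * (grid n j - a)"
      using assms(2) by (intro mult_left_mono) auto
    then show "c * real (j - Min J1 + 1) \<le> N * \<bar>a - grid n j\<bar>"
      using j by (simp add: c_def J1_def)
  next
    show "inj_on (\<lambda>j. j - Min J1 + 1) J1"
    proof (rule inj_onI)
      fix i j assume "i \<in> J1" "j \<in> J1" "i - Min J1 + 1 = j - Min J1 + 1"
      moreover from this have "Min J1 \<le> i" "Min J1 \<le> j" using fin12 by auto
      ultimately show "i = j" by linarith
    qed
  qed simp
  moreover have "(\<Sum>j\<in>J2. profile (N * \<bar>a - grid n j\<bar>)) \<le> 4 / c"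
  proof (rule sum_profile_inj_le[OF fin12(2) c])
    fix j assume j: "j \<in> J2"
    then have m: "Max J2 \<in> J2" "j \<le> Max J2"
      using fin12 by (auto intro: Max_in)
    have "a - grid n j = (grid n (Max J2) - grid n j) + (a - grid n (Max J2))" by simp
    also have "\<dots> \<ge> (real (Max J2) - real j) / (2 * real n) + 1 / (4 * real n)"
      using far[of "Max J2"] m assms(1) by (simp add: grid_diff J2_def)
    finally have "real (Max J2 - j + 1) / (4 * real n) \<le> a - grid n j"
      using m assms(1) by (simp add: of_nat_diff field_simps)
    then have "N * (real (Max J2 - j + 1) / (4 * real n)) \<le> N * (a - grid n j)"
      using assms(2) by (intro mult_left_mono) auto
    then show "c * real (Max J2 - j + 1) \<le> N * \<bar>a - grid n j\<bar>"
      using j by (simp add: c_def J2_def)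
  next
    show "inj_on (\<lambda>j. Max J2 - j + 1) J2"
    proof (rule inj_onI)
      fix i j assume "i \<in> J2" "j \<in> J2" "Max J2 - i + 1 = Max J2 - j + 1"
      moreover from this have "i \<le> Max J2" "j \<le> Max J2" using fin12 by auto
      ultimately show "i = j" by linarith
    qed
  qed simp
  moreover have "J = J1 \<union> J2" "J1 \<inter> J2 = {}" by (auto simp: J1_def J2_def)
  ultimately have "(\<Sum>j\<in>J. profile (N * \<bar>a - grid n j\<bar>)) \<le> 4 / c + 4 / c"
    using fin12 by (simp add: sum.union_disjoint)
  then show ?thesis by (simp add: c_def)
qed

text \<open>
  Since \<open>profile 0 = 0\<close> is a junk value, points on the separator are charged separately:
  \<open>1 - u / u\<close> is \<open>1\<close> for \<open>u = 0\<close> and vanishes otherwise.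
\<close>

definition charge :: "nat \<Rightarrow> nat \<Rightarrow> real \<Rightarrow> real" where
  "charge n N u = profile (real N * u) + 33 * real n * (1 - u / u)"

lemma charge_pos: "n > 0 \<Longrightarrow> N > 0 \<Longrightarrow> u \<ge> 0 \<Longrightarrow> charge n N u > 0"
  by (cases "u = 0") (auto simp: charge_def profile_pos, simp add: profile_def)

text \<open>Each point comes within half a cell of at most one grid value, so at least
  \<open>n\<close> of the \<open>2 * n\<close> indices survive in \<open>J\<close>. There the extra
  term of \<open>charge\<close> vanishes, and exchanging the sums bounds the average charge.\<close>

lemma exists_light_grid_point:
  fixes a :: "'a \<Rightarrow> real"
  assumes "finite P" "card P = n" "n > 0" "N > 0"
  shows "\<exists>j<2 * n. (\<Sum>x\<in>P. charge n N \<bar>a x - grid n j\<bar>) \<le> 32 * real n / real N"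
proof (rule ccontr)
  assume "\<not> ?thesis"
  then have heavy: "32 * real n / real N < (\<Sum>x\<in>P. charge n N \<bar>a x - grid n j\<bar>)" if "j < 2 * n" for j
    using that by force
  define J where "J = {j. j < 2 * n \<and> (\<forall>x\<in>P. \<bar>a x - grid n j\<bar> \<ge> 1 / (4 * real n))}"
  have Jsub: "J \<subseteq> {..<2 * n}" "finite J" by (auto simp: J_def)
  have hit: "card {j. j < 2 * n \<and> \<bar>a x - grid n j\<bar> < 1 / (4 * real n)} \<le> 1" for x
  proof -
    have "i = j" if "\<bar>a x - grid n i\<bar> < 1 / (4 * real n)" "\<bar>a x - grid n j\<bar> < 1 / (4 * real n)" for i j
    proof -
      have "\<bar>grid n i - grid n j\<bar> < 1 / (4 * real n) + 1 / (4 * real n)"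
        using that by linarith
      then have "\<bar>real i - real j\<bar> < 1"
        using assms(3) by (simp add: grid_diff field_simps)
      then show "i = j" by linarith
    qed
    then show ?thesis by (intro card_le_Suc0_iff_eq[THEN iffD2, unfolded One_nat_def[symmetric]]) auto
  qed
  have "{..<2 * n} - J \<subseteq> (\<Union>x\<in>P. {j. j < 2 * n \<and> \<bar>a x - grid n j\<bar> < 1 / (4 * real n)})"
    by (auto simp: J_def not_le)
  then have "card ({..<2 * n} - J) \<le> card (\<Union>x\<in>P. {j. j < 2 * n \<and> \<bar>a x - grid n j\<bar> < 1 / (4 * real n)})"
    using assms(1) by (intro card_mono) auto
  also have "\<dots> \<le> (\<Sum>x\<in>P. card {j. j < 2 * n \<and> \<bar>a x - grid n j\<bar> < 1 / (4 * real n)})"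
    by (rule card_UN_le[OF assms(1)])
  also have "\<dots> \<le> (\<Sum>x\<in>P. 1)" by (intro sum_mono hit)
  finally have "card ({..<2 * n} - J) \<le> n" using assms(2) by simp
  then have cardJ: "n \<le> card J"
    using Jsub by (simp add: card_Diff_subset)
  have "(\<Sum>j\<in>J. \<Sum>x\<in>P. charge n N \<bar>a x - grid n j\<bar>)
      = (\<Sum>j\<in>J. \<Sum>x\<in>P. profile (real N * \<bar>a x - grid n j\<bar>))"
  proof (intro sum.cong refl)
    fix j x assume "j \<in> J" "x \<in> P"
    then have "1 / (4 * real n) \<le> \<bar>a x - grid n j\<bar>" by (simp add: J_def)
    moreover have "0 < 1 / (4 * real n)" using assms(3) by simp
    ultimately have "\<bar>a x - grid n j\<bar> \<noteq> 0" by linarith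
    then show "charge n N \<bar>a x - grid n j\<bar> = profile (real N * \<bar>a x - grid n j\<bar>)"
      by (simp add: charge_def)
  qed
  also have "\<dots> = (\<Sum>x\<in>P. \<Sum>j\<in>J. profile (real N * \<bar>a x - grid n j\<bar>))"
    by (rule sum.swap)
  also have "\<dots> \<le> (\<Sum>x\<in>P. 32 * real n / real N)"
    using assms Jsub by (intro sum_mono sum_grid_le) (auto simp: J_def)
  also have "\<dots> = real n * (32 * real n / real N)"
    using assms(2) by simp
  also have "\<dots> \<le> real (card J) * (32 * real n / real N)"
    using cardJ by (intro mult_right_mono) auto
  also have "\<dots> = (\<Sum>j\<in>J. 32 * real n / real N)" by simp
  also have "\<dots> < (\<Sum>j\<in>J. \<Sum>x\<in>P. charge n N \<bar>a x - grid n j\<bar>)"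
  proof (rule sum_strict_mono)
    show "finite J" "J \<noteq> {}" using cardJ assms(3) Jsub by auto
  qed (use heavy in \<open>auto simp: J_def\<close>)
  finally show False by simp
qed

section \<open>Growth of the reciprocal profile\<close>

lemma power_le_imp_le_base4: "x ^ 4 \<le> y ^ 4 \<Longrightarrow> 0 \<le> y \<Longrightarrow> x \<le> (y::real)"
  using power_le_imp_le_base[of x 3 y] by (simp add: numeral_eq_Suc)

text \<open>Comparing fourth powers avoids fractional exponents: \<open>z ^ 3\<close> decays like
  \<open>(2/3) ^ j\<close> because 1/8 is at most 16/81. The other factor is bounded, as
  \<open>z\<close> is at most 3/2.\<close>

lemma inverse_profile_le_neg:
  assumes "i < 0"
  shows "1 / profile (4 * 2 powi i) \<le> 64 * (3 / 2) powi i"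
proof -
  define z where "z = sqrt (sqrt (4 * 2 powi i))"
  obtain j where j: "i = - int j" "j > 0"
    using assms by (metis neg_0_less_iff_less nonneg_int_cases less_imp_le minus_minus of_nat_0_less_iff)
  have z0: "z \<ge> 0" by (simp add: z_def)
  have "z ^ 4 = ((z)\<^sup>2)\<^sup>2" by simp
  then have z4: "z ^ 4 = 4 * 2 powi i" by (simp add: z_def)
  have two: "2 powi i = (1 / 2 :: real) ^ j" "(3 / 2) powi i = (2 / 3 :: real) ^ j"
    unfolding j by (simp_all add: power_int_minus power_inverse[symmetric])
  have "(1 / 2 :: real) ^ j \<le> 1 / 2"
    using j power_decreasing[of 1 j "1/2::real"] by simp
  then have "z ^ 4 \<le> (3 / 2) ^ 4"
    unfolding z4 two by (simp add: power4_eq_xxxx)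
  then have z1: "z \<le> 3 / 2"
    by (rule power_le_imp_le_base4) simp
  have "(z ^ 3) ^ 4 = (z ^ 4) ^ 3" by (simp flip: power_mult)
  also have "\<dots> = 64 * (1 / 8) ^ j"
    unfolding z4 two by (simp add: power_mult_distrib flip: power_mult) (simp add: power_mult mult.commute[of j] power3_eq_cube)
  also have "\<dots> \<le> 81 * (16 / 81) ^ j"
    by (intro mult_mono power_mono) auto
  also have "\<dots> = (3 * (2 / 3) ^ j) ^ 4"
    by (simp add: power_mult_distrib flip: power_mult) (simp add: power_mult mult.commute[of j] power4_eq_xxxx)
  finally have z3: "z ^ 3 \<le> 3 * (2 / 3) ^ j"
    by (rule power_le_imp_le_base4) simp
  have "z ^ 3 * (1 + z)\<^sup>2 \<le> (3 * (2 / 3) ^ j) * (5 / 2)\<^sup>2"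
    using z3 z1 z0 by (intro mult_mono power_mono) auto
  also have "\<dots> \<le> 64 * (2 / 3) ^ j" by (simp add: power2_eq_square)
  finally show ?thesis
    unfolding profile_def two(2) by (simp add: z_def)
qed

lemma inverse_profile_le_nonneg:
  assumes "i \<ge> 0"
  shows "1 / profile (4 * 2 powi i) \<le> 64 * 4 powi i"
proof -
  define z where "z = sqrt (sqrt (4 * 2 powi i))"
  obtain j where j: "i = int j" using assms nonneg_int_cases by blast
  have "z ^ 4 = ((z)\<^sup>2)\<^sup>2" by simp
  then have z4: "z ^ 4 = 4 * 2 ^ j" by (simp add: z_def j)
  have "(2::real) ^ j \<ge> 1" by simp
  then have "1 \<le> 4 * (2::real) ^ j" by linarith
  then have z1: "z \<ge> 1" by (simp add: z_def j)
  have "z ^ 3 * (1 + z)\<^sup>2 \<le> z ^ 3 * (2 * z)\<^sup>2"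
    using z1 by (intro mult_left_mono power_mono) auto
  also have "\<dots> = 4 * z ^ 5" by (simp add: power_mult_distrib flip: power_add)
  \<comment> \<open>Exponent 8 makes the bound a square of \<open>z ^ 4\<close>, hence a multiple of
    \<open>4 ^ j\<close>; the constant is 4 * 16 = 64.\<close>
  also have "\<dots> \<le> 4 * z ^ 8"
    using z1 by (intro mult_left_mono power_increasing) auto
  also have "z ^ 8 = (z ^ 4)\<^sup>2" by (simp flip: power_mult)
  also have "(z ^ 4)\<^sup>2 = 16 * 4 ^ j"
    unfolding z4 by (simp add: power_mult_distrib flip: power_mult) (simp add: power_mult mult.commute[of j] power2_eq_square)
  finally show ?thesis
    by (simp add: profile_def z_def j)
qed

section \<open>Good separators around a crowded point\<close>

definition crowded :: "(real ^ 'd::finite) set \<Rightarrow> real ^ 'd \<Rightarrow> real \<Rightarrow> bool" where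
  "crowded P p s \<longleftrightarrow> card P \<le> (4 ^ CARD('d) + 1) * card {x \<in> P. infnorm (x - p) \<le> s}"

text \<open>The minimality ranges over all centres, not only \<open>p\<close>; thus it restricts
  sets of small diameter wherever they lie.\<close>

definition smallest_crowded :: "(real ^ 'd::finite) set \<Rightarrow> real ^ 'd \<Rightarrow> real \<Rightarrow> bool" where
  "smallest_crowded P p r \<longleftrightarrow> p \<in> P \<and> 0 < r \<and> crowded P p r \<and>
     (\<forall>p'\<in>P. \<forall>q'\<in>P. p' \<noteq> q' \<longrightarrow> crowded P p' (infnorm (q' - p')) \<longrightarrow> r \<le> infnorm (q' - p'))"

lemma powr_card_split: "n > 0 \<Longrightarrow> real n = real n powr (1 / real CARD('d::finite)) * real n powr (1 - 1 / real CARD('d))"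
  by (simp flip: powr_add)

lemma powr_card_le: "n > 0 \<Longrightarrow> real n powr (1 / real CARD('d::finite)) \<le> real n"
  using powr_mono[of "1 / real CARD('d)" 1 "real n"] by (simp add: Suc_le_eq)

text \<open>Here a single point already makes a cube crowded, so \<open>r\<close> is at most every
  distance between two points and the cube isolates \<open>p\<close>. The sets
  \<open>near P i\<close> are empty for \<open>i < -1\<close>; otherwise the trivial bound
  \<open>n\<close> suffices, as \<open>N\<close> is bounded by a constant.\<close>

lemma good_separator_few_points:
  fixes P :: "(real ^ 'd::finite) set"
  assumes fin: "finite P" and two: "card P \<ge> 2" and few: "card P \<le> 4 ^ CARD('d) + 1"
    and r: "smallest_crowded P p r" and C: "C \<ge> 2 * (4 ^ CARD('d) + 1)"
  shows "good_separator C P (centred p (r / 2))"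
proof -
  define n where "n = card P"
  define N where "N = real n powr (1 / real CARD('d))"
  have p: "p \<in> P" "0 < r" using r by (auto simp: smallest_crowded_def)
  have n2: "n \<ge> 2" using two by (simp add: n_def)
  have far: "r \<le> infnorm (x - p)" if "x \<in> P" "x \<noteq> p" for x
  proof -
    have "{x, p} \<subseteq> {y \<in> P. infnorm (y - p) \<le> infnorm (x - p)}"
      using that p by (auto simp: infnorm_0 infnorm_pos_le)
    then have "card {x, p} \<le> card {y \<in> P. infnorm (y - p) \<le> infnorm (x - p)}"
      using fin by (intro card_mono) auto
    then have "1 \<le> card {y \<in> P. infnorm (y - p) \<le> infnorm (x - p)}"
      using that by simp
    from mult_le_mono2[OF this, of "4 ^ CARD('d) + 1"] have "crowded P p (infnorm (x - p))"
      using few unfolding crowded_def mult_1_right by (rule order_trans[rotated])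
    moreover have "\<forall>p'\<in>P. \<forall>q'\<in>P. p' \<noteq> q' \<longrightarrow> crowded P p' (infnorm (q' - p')) \<longrightarrow> r \<le> infnorm (q' - p')"
      using r unfolding smallest_crowded_def by (elim conjE)
    ultimately show ?thesis using p that by metis
  qed
  have "P \<inter> sep_in (centred p (r / 2)) = {p}"
  proof (intro equalityI subsetI)
    fix x assume "x \<in> P \<inter> sep_in (centred p (r / 2))"
    then have "x \<in> P" "infnorm (x - p) \<le> r / 2" by (auto simp: sep_in_centred)
    then show "x \<in> {p}" using far[of x] p by (cases "x = p") auto
  qed (use p in \<open>auto simp: sep_in_centred infnorm_0\<close>)
  moreover have "P \<inter> sep_out (centred p (r / 2)) = P - P \<inter> sep_in (centred p (r / 2))"
    by (auto simp: sep_out_def)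
  ultimately have card_in: "card (P \<inter> sep_in (centred p (r / 2))) = 1"
      and card_out: "card (P \<inter> sep_out (centred p (r / 2))) = n - 1"
    using p fin by (simp_all add: n_def)
  have bal: "balanced P (centred p (r / 2))"
  proof -
    \<comment> \<open>Equivalent to \<open>n\<close> being at most \<open>4 ^ CARD('d) + 1\<close>,
      which is \<open>few\<close>.\<close>
    have "real n - 1 \<le> 4 ^ CARD('d) / (4 ^ CARD('d) + 1) * real n"
    proof -
      have "real n \<le> real (4 ^ CARD('d) + 1)"
        using few unfolding n_def of_nat_le_iff .
      then have "real n / (4 ^ CARD('d) + 1) \<le> 1"
        by (simp add: divide_le_eq_1 add_pos_pos)
      moreover have "real n / (4 ^ CARD('d) + 1) + 4 ^ CARD('d) / (4 ^ CARD('d) + 1) * real n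
          = (4 ^ CARD('d) + 1) * real n / (4 ^ CARD('d) + 1)"
        by (simp add: add_divide_distrib distrib_right add.commute)
      moreover have "\<dots> = real n"
        by (rule nonzero_mult_div_cancel_left) (smt (verit) zero_less_power)
      ultimately show ?thesis by linarith
    qed
    moreover have "1 \<le> real n - 1" using n2 by simp
    ultimately show ?thesis
      unfolding balanced_def card_in card_out using n2 by (simp add: n_def[symmetric] of_nat_diff)
  qed
  have rd: "rdist x (centred p (r / 2)) \<ge> 1 / 2" if "x \<in> P" for x
  proof -
    have "r / 2 \<le> \<bar>infnorm (x - p) - r / 2\<bar>"
      using far[OF that] p by (cases "x = p") (auto simp: infnorm_0)
    also have "\<dots> \<le> dist_inf x (centred p (r / 2))"
      using p by (intro dist_inf_centred_ge) auto
    finally show ?thesis using p by (simp add: rdist_def field_simps)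
  qed
  have N1: "1 \<le> N" unfolding N_def using n2 by (intro ge_one_powr_ge_zero) auto
  have near_empty: "near P i (centred p (r / 2)) = {}" if "i < -1" for i
  proof -
    have "(2::real) powi i \<le> 2 powi (-2)"
      using that by (intro power_int_increasing) auto
    then have "2 powi i < (1 / 2 :: real)" by (simp add: power_int_minus)
    moreover have "2 powi i / N \<le> 2 powi i / (1::real)"
      using N1 by (intro divide_left_mono) auto
    ultimately have "2 powi i / N < 1 / 2" unfolding div_by_1 by (rule le_less_trans[rotated])
    moreover have "1 / 2 \<le> 2 powi i / N" if "x \<in> near P i (centred p (r / 2))" for x
      using that rd[of x] unfolding near_def N_def n_def by (elim CollectE conjE) (rule order_trans)
    ultimately show ?thesis by fastforce
  qed
  define D where "D = (4::real) ^ CARD('d) + 1"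
  define W where "W = real n powr (1 - 1 / real CARD('d))"
  have W0: "W \<ge> 0" by (simp add: W_def)
  have D1: "D \<ge> 1" by (simp add: D_def)
  have C2: "2 * D \<le> C" using C by (simp add: D_def)
  have N_le: "N \<le> D"
  proof -
    have "N \<le> real n" unfolding N_def using n2 by (intro powr_card_le) auto
    also have "\<dots> \<le> real (4 ^ CARD('d) + 1)"
      using few unfolding n_def of_nat_le_iff .
    finally show ?thesis by (simp add: D_def)
  qed
  have near_le: "real (card (near P i (centred p (r / 2)))) \<le> D * W" for i
  proof -
    have "card (near P i (centred p (r / 2))) \<le> n"
      unfolding n_def using fin by (intro card_mono) (auto simp: near_def)
    then have "real (card (near P i (centred p (r / 2)))) \<le> real n"
      by (simp only: of_nat_le_iff)
    also have "real n = N * W"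
      unfolding N_def W_def using n2 by (intro powr_card_split) auto
    also have "\<dots> \<le> D * W"
      using N_le W0 by (rule mult_right_mono)
    finally show ?thesis .
  qed
  \<comment> \<open>2/3 is the factor for \<open>i = -1\<close>, the least one over all
    \<open>i \<ge> -1\<close>; the 2 in the bound on \<open>C\<close> compensates for it.\<close>
  have bound: "real (card (near P i (centred p (r / 2)))) \<le> C * (b * W)" if "b \<ge> 2 / 3" for i b
  proof -
    have "D \<le> C * b"
      using mult_mono[OF C2 that] C2 D1 by simp
    then have "D * W \<le> C * b * W" using W0 by (rule mult_right_mono)
    with near_le[of i] show ?thesis by (simp add: mult.assoc)
  qed
  show ?thesis
    unfolding good_separator_def n_def[symmetric] W_def[symmetric]
  proof (intro conjI allI impI)
    show "is_separator (centred p (r / 2))" using p by (simp add: is_separator_def)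
    show "balanced P (centred p (r / 2))" by (rule bal)
  next
    fix i :: int assume i: "i < 0"
    show "real (card (near P i (centred p (r / 2)))) \<le> C * ((3 / 2) powi i * W)"
    proof (cases "i = -1")
      case True
      then have "(3 / 2 :: real) powi i = 2 / 3" by (simp add: power_int_minus)
      then show ?thesis by (intro bound) simp
    next
      case False
      then have "near P i (centred p (r / 2)) = {}" using i by (intro near_empty) simp
      then show ?thesis using W0 C2 D1 by simp
    qed
  next
    fix i :: int assume "i \<ge> 0"
    then have "(1::real) \<le> 4 powi i" by (intro one_le_power_int) auto
    then show "real (card (near P i (centred p (r / 2)))) \<le> C * (4 powi i * W)"
      by (intro bound) simp
  qed
qed

text \<open>The crowded cube of radius \<open>r\<close> leaves at most \<open>n - n / D\<close>
  points outside, and the \<open>4 ^ d\<close> cells hold at most \<open>n / D\<close> points each.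
  Both bounds equal the balance bound, since 1 - 1/D = (D - 1)/D.\<close>

lemma balanced_centred:
  fixes P :: "(real ^ 'd::finite) set"
  assumes fin: "finite P" and many: "card P > 4 ^ CARD('d) + 1"
    and r: "smallest_crowded P p r" and h: "r \<le> h" "h < 2 * r"
  shows "balanced P (centred p h)"
proof -
  define n where "n = card P"
  define D where "D = (4::real) ^ CARD('d) + 1"
  have D: "D > 0" by (simp add: D_def add_pos_pos)
  have p: "p \<in> P" "0 < r" using r by (auto simp: smallest_crowded_def)
  define I where "I = P \<inter> sep_in (centred p h)"
  have I: "I = {x \<in> P. infnorm (x - p) \<le> h}" by (auto simp: I_def sep_in_centred)
  have finI: "finite I" using fin by (simp add: I)
  have "real (card P) \<le> real ((4 ^ CARD('d) + 1) * card {x \<in> P. infnorm (x - p) \<le> r})"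
    using r unfolding smallest_crowded_def crowded_def of_nat_le_iff by blast
  then have "real n \<le> D * real (card {x \<in> P. infnorm (x - p) \<le> r})"
    by (simp add: D_def n_def algebra_simps)
  also have "\<dots> \<le> D * real (card I)"
    using h finI D by (intro mult_left_mono) (auto simp: I intro!: card_mono)
  finally have lower: "real n \<le> D * real (card I)" .
  have "real (card I) \<le> 4 ^ CARD('d) * (real n / D)"
    unfolding I
  proof (rule card_cube_le[where r = r])
    fix T assume T: "T \<subseteq> P" and diam: "\<And>x y. x \<in> T \<Longrightarrow> y \<in> T \<Longrightarrow> infnorm (x - y) < r"
    have finT: "finite T" using T fin finite_subset by blast
    show "real (card T) \<le> real n / D"
    proof (rule ccontr)
      assume "\<not> ?thesis"
      then have gt: "real n < D * real (card T)" using D by (simp add: field_simps)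
      have "real (card P) < real ((4 ^ CARD('d) + 1) * card T)"
        using gt by (simp add: D_def n_def algebra_simps)
      then have big: "card P < (4 ^ CARD('d) + 1) * card T"
        unfolding of_nat_less_iff .
      \<comment> \<open>Here \<open>many\<close> is essential: it forces an overfull set to have two
        distinct points.\<close>
      with many have "(4 ^ CARD('d) + 1) * 1 < (4 ^ CARD('d) + 1) * card T"
        unfolding mult_1_right by (rule less_trans)
      then have "card T > 1" unfolding mult_less_cancel1 by blast
      then obtain a b where ab: "a \<in> T" "b \<in> T" "a \<noteq> b"
        by (metis One_nat_def card_le_Suc0_iff_eq finT not_le)
      define s where "s = Max ((\<lambda>x. infnorm (x - a)) ` T)"
      have "s \<in> (\<lambda>x. infnorm (x - a)) ` T"
        unfolding s_def using finT ab by (intro Max_in) auto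
      then obtain q where q: "q \<in> T" "s = infnorm (q - a)" by blast
      have le: "infnorm (x - a) \<le> s" if "x \<in> T" for x
        unfolding s_def using that finT by simp
      have "0 < infnorm (b - a)" using ab by (simp add: infnorm_pos_lt)
      then have "q \<noteq> a" using le[OF ab(2)] q by (auto simp: infnorm_0)
      \<comment> \<open>The farthest point \<open>q\<close> gives a radius about \<open>a\<close>
        that covers all of \<open>T\<close>, yet is below \<open>r\<close> by the diameter
        bound.\<close>
      have "card T \<le> card {x \<in> P. infnorm (x - a) \<le> s}"
        using T le fin by (intro card_mono) auto
      then have "(4 ^ CARD('d) + 1) * card T \<le> (4 ^ CARD('d) + 1) * card {x \<in> P. infnorm (x - a) \<le> s}"
        by (rule mult_le_mono2)
      from less_imp_le[OF less_le_trans[OF big this]] have "crowded P a s" unfolding crowded_def .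
      moreover have "\<forall>p'\<in>P. \<forall>q'\<in>P. p' \<noteq> q' \<longrightarrow> crowded P p' (infnorm (q' - p')) \<longrightarrow> r \<le> infnorm (q' - p')"
        using r unfolding smallest_crowded_def by (elim conjE)
      moreover have "a \<in> P" "q \<in> P" using ab q T by auto
      ultimately have "r \<le> s" using \<open>q \<noteq> a\<close> q(2) by metis
      with diam[OF q(1) ab(1)] q show False by simp
    qed
  qed (use fin p h D in auto)
  then have inside: "real (card I) \<le> 4 ^ CARD('d) / D * real n" by simp
  have "P \<inter> sep_out (centred p h) = P - I" by (auto simp: I_def sep_out_def)
  then have "real (card (P \<inter> sep_out (centred p h))) = real n - real (card I)"
    using finI fin by (simp add: card_Diff_subset I n_def of_nat_diff card_mono)
  also have "\<dots> \<le> real n - real n / D"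
    using lower D by (simp add: field_simps)
  also have "\<dots> = 4 ^ CARD('d) / D * real n"
    using D by (simp add: field_simps) (simp add: D_def algebra_simps)
  finally show ?thesis
    using inside unfolding balanced_def by (simp add: I_def D_def n_def)
qed

text \<open>Markov's inequality: each point of \<open>near P i\<close> is charged at least
  \<open>profile (4 * 2 powi i)\<close>, while the total charge is at most \<open>64 * W\<close>. As
  \<open>N\<close> is the integer part of the root, it differs from the root by a factor of at most
  2.\<close>

lemma good_separator_many_points:
  fixes P :: "(real ^ 'd::finite) set"
  assumes fin: "finite P" and many: "card P > 4 ^ CARD('d) + 1"
    and r: "smallest_crowded P p r" and y: "1 < y" "y < 2"
    and N: "0 < N" "N ^ CARD('d) \<le> card P" "card P < (N + 1) ^ CARD('d)"
    and light: "(\<Sum>x\<in>P. charge (card P) N \<bar>infnorm (x - p) / r - y\<bar>) \<le> 32 * real (card P) / real N"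
    and C: "C \<ge> 4096"
  shows "good_separator C P (centred p (y * r))"
proof -
  define n where "n = card P"
  define W where "W = real n powr (1 - 1 / real CARD('d))"
  define u where "u x = \<bar>infnorm (x - p) / r - y\<bar>" for x
  have p: "p \<in> P" "0 < r" using r by (auto simp: smallest_crowded_def)
  have n0: "n > 0" using many by (simp add: n_def)
  have N_le: "real N \<le> real n powr (1 / real CARD('d))"
  proof -
    have "real N = (real N ^ CARD('d)) powr (1 / real CARD('d))"
      using N(1) by (simp add: powr_powr flip: powr_realpow)
    also have "\<dots> \<le> real n powr (1 / real CARD('d))"
      using N(2) by (intro powr_mono2) (auto simp: n_def simp flip: of_nat_power)
    finally show ?thesis .
  qed
  have N_ge: "real n powr (1 / real CARD('d)) \<le> 2 * real N"
  proof -
    have "real n powr (1 / real CARD('d)) \<le> (real (N + 1) ^ CARD('d)) powr (1 / real CARD('d))"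
      using N(3) by (intro powr_mono2) (auto simp: n_def simp flip: of_nat_power simp del: of_nat_Suc of_nat_add)
    also have "\<dots> = real (N + 1)"
      by (simp add: powr_powr flip: powr_realpow)
    finally show ?thesis using N(1) by simp
  qed
  have nN: "real n / real N \<le> 2 * W"
    using powr_card_split[of n, where 'd='d] n0 N(1) mult_right_mono[OF N_ge, of W]
    by (simp add: W_def field_simps)
  \<comment> \<open>A point on the separator would alone be charged \<open>33 * n\<close>, more than
    the permitted total.\<close>
  have u0: "u x > 0" if "x \<in> P" for x
  proof (rule ccontr)
    assume "\<not> u x > 0"
    then have "u x = 0" by (simp add: u_def)
    have "charge n N (u x) \<le> (\<Sum>x\<in>P. charge n N (u x))"
      using fin that n0 N(1) by (intro member_le_sum less_imp_le[OF charge_pos]) (auto simp: u_def)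
    also have "\<dots> \<le> 32 * real n / real N" using light by (simp add: n_def u_def)
    also have "\<dots> \<le> 32 * real n / 1"
      using N(1) by (intro divide_left_mono) auto
    finally show False using n0 by (simp add: \<open>u x = 0\<close> charge_def profile_def)
  qed
  then have sum_le: "(\<Sum>x\<in>P. profile (real N * u x)) \<le> 32 * real n / real N"
    using light by (simp add: charge_def u_def n_def)
  \<comment> \<open>The side length is \<open>2 * y * r\<close>, so \<open>u x\<close> is at most
    \<open>2 * y\<close> times the relative distance, and \<open>y < 2\<close>.\<close>
  have near_u: "real N * u x \<le> 4 * 2 powi i" if "x \<in> near P i (centred p (y * r))" for x i
  proof -
    have yr: "y * r > 0" using y p by simp
    have "u x * r = \<bar>(infnorm (x - p) / r - y) * r\<bar>" using p by (simp add: u_def abs_mult)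
    also have "(infnorm (x - p) / r - y) * r = infnorm (x - p) - y * r"
      using p by (simp add: field_simps)
    finally have "u x * r \<le> dist_inf x (centred p (y * r))"
      using dist_inf_centred_ge[OF yr, of x p] by simp
    then have "u x * r / (2 * (y * r)) \<le> dist_inf x (centred p (y * r)) / (2 * (y * r))"
      using yr by (intro divide_right_mono) auto
    also have "\<dots> \<le> 2 powi i / real n powr (1 / real CARD('d))"
      using that by (simp add: near_def rdist_def n_def)
    also have "\<dots> \<le> 2 powi i / real N"
      using N_le N(1) n0 by (intro divide_left_mono) auto
    finally have "u x / (2 * y) \<le> 2 powi i / real N" using p by simp
    then have "real N * u x \<le> 2 * y * 2 powi i"
      using y N(1) by (simp add: field_simps)
    also have "\<dots> \<le> 4 * 2 powi i" using y by (intro mult_right_mono) auto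
    finally show ?thesis .
  qed
  have card_near: "real (card (near P i (centred p (y * r)))) \<le> 64 * W * (1 / profile (4 * 2 powi i))" for i
  proof -
    let ?T = "near P i (centred p (y * r))"
    have T: "?T \<subseteq> P" by (auto simp: near_def)
    have "real (card ?T) * profile (4 * 2 powi i) = (\<Sum>x\<in>?T. profile (4 * 2 powi i))" by simp
    also have "\<dots> \<le> (\<Sum>x\<in>?T. profile (real N * u x))"
      using T u0 N(1) near_u by (intro sum_mono profile_antimono) auto
    also have "\<dots> \<le> (\<Sum>x\<in>P. profile (real N * u x))"
      using T fin by (intro sum_mono2 profile_nonneg) (auto simp: u_def)
    also have "\<dots> \<le> 64 * W" using sum_le nN by simp
    finally show ?thesis
      using profile_pos[of "4 * 2 powi i"] by (simp add: field_simps)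
  qed
  have W0: "W \<ge> 0" by (simp add: W_def)
  have bound: "real (card (near P i (centred p (y * r)))) \<le> C * (b * W)"
    if "1 / profile (4 * 2 powi i) \<le> 64 * b" "b \<ge> 0" for i b
  proof -
    have "real (card (near P i (centred p (y * r)))) \<le> 64 * W * (64 * b)"
      using card_near[of i] that W0 by (meson mult_left_mono order_trans mult_nonneg_nonneg zero_le_numeral)
    also have "\<dots> = 4096 * (b * W)" by simp
    also have "\<dots> \<le> C * (b * W)" using C W0 that by (intro mult_right_mono) auto
    finally show ?thesis .
  qed
  show ?thesis
    unfolding good_separator_def n_def[symmetric] W_def[symmetric]
  proof (intro conjI allI impI)
    show "is_separator (centred p (y * r))" using p y by (simp add: is_separator_def)
    show "balanced P (centred p (y * r))"
      using p y by (intro balanced_centred[OF fin many r]) auto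
  qed (auto intro!: bound inverse_profile_le_neg inverse_profile_le_nonneg)
qed

section \<open>Running times of programs with bounded loops\<close>

fun weight :: "com \<Rightarrow> nat" where
  "weight Skip = 1"
| "weight (NStore a e) = 1 + ncost a + ncost e"
| "weight (RStore a e) = 1 + ncost a + rcost e"
| "weight (Seq c1 c2) = weight c1 + weight c2"
| "weight (Cond b c1 c2) = 1 + bcost b + weight c1 + weight c2"
| "weight (While b c) = 3 * (1 + bcost b + weight c)"

fun loop_depth :: "com \<Rightarrow> nat" where
  "loop_depth (Seq c1 c2) = max (loop_depth c1) (loop_depth c2)"
| "loop_depth (Cond b c1 c2) = max (loop_depth c1) (loop_depth c2)"
| "loop_depth (While b c) = Suc (loop_depth c)"
| "loop_depth _ = 0"

text \<open>
  The time bound is determined by the syntax of the program alone; it accounts for loops of at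
  most \<open>2 * n\<close> iterations, which explains the factor \<open>3\<close> in \<^const>\<open>weight\<close>.
\<close>

definition runs :: "nat \<Rightarrow> com \<Rightarrow> mem \<Rightarrow> (mem \<Rightarrow> bool) \<Rightarrow> bool" where
  "runs n c m Q \<longleftrightarrow> (\<exists>t m'. exec c m t m' \<and> t \<le> weight c * n ^ loop_depth c \<and> Q m')"

lemma runs_mono: "runs n c m Q \<Longrightarrow> (\<And>m'. Q m' \<Longrightarrow> Q' m') \<Longrightarrow> runs n c m Q'"
  by (auto simp: runs_def)

lemma runs_Skip: "Q m \<Longrightarrow> runs n Skip m Q"
  by (force simp: runs_def intro: exec.Skip)

lemma runs_NStore: "Q (m\<lparr>nmem := (nmem m)(nval a m := nval e m)\<rparr>) \<Longrightarrow> runs n (NStore a e) m Q"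
  unfolding runs_def by (rule exI, rule exI, rule conjI, rule exec.NStore) simp

lemma runs_RStore: "Q (m\<lparr>rmem := (rmem m)(nval a m := rval e m)\<rparr>) \<Longrightarrow> runs n (RStore a e) m Q"
  unfolding runs_def by (rule exI, rule exI, rule conjI, rule exec.RStore) simp

lemma runs_Seq:
  assumes "n \<ge> 1" "runs n c1 m (\<lambda>m'. runs n c2 m' Q)"
  shows "runs n (Seq c1 c2) m Q"
proof -
  let ?e = "max (loop_depth c1) (loop_depth c2)"
  obtain t1 m1 where 1: "exec c1 m t1 m1" "t1 \<le> weight c1 * n ^ loop_depth c1" "runs n c2 m1 Q"
    using assms(2) by (auto simp: runs_def)
  then obtain t2 m2 where 2: "exec c2 m1 t2 m2" "t2 \<le> weight c2 * n ^ loop_depth c2" "Q m2"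
    by (auto simp: runs_def)
  have "n ^ loop_depth c1 \<le> n ^ ?e" "n ^ loop_depth c2 \<le> n ^ ?e"
    using assms(1) by (auto intro: power_increasing)
  then have "t1 + t2 \<le> weight c1 * n ^ ?e + weight c2 * n ^ ?e"
    using 1(2) 2(2) by (meson add_mono mult_le_mono2 order_trans)
  then show ?thesis
    unfolding runs_def using exec.Seq[OF 1(1) 2(1)] 2(3) by (auto simp: algebra_simps)
qed

lemma runs_Cond:
  assumes "n \<ge> 1" "bval b m \<Longrightarrow> runs n c1 m Q" "\<not> bval b m \<Longrightarrow> runs n c2 m Q"
  shows "runs n (Cond b c1 c2) m Q"
proof -
  let ?e = "max (loop_depth c1) (loop_depth c2)"
  have mono: "n ^ loop_depth c1 \<le> n ^ ?e" "n ^ loop_depth c2 \<le> n ^ ?e" "1 \<le> n ^ ?e"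
    using assms(1) by (auto intro: power_increasing)
  have bound: "1 + bcost b + t \<le> weight (Cond b c1 c2) * n ^ ?e"
    if "t \<le> weight c * n ^ loop_depth c" "c = c1 \<or> c = c2" for t c
  proof -
    have "t \<le> weight c * n ^ ?e"
      using that mono by (meson mult_le_mono2 order_trans)
    also have "\<dots> \<le> (weight c1 + weight c2) * n ^ ?e"
      using that(2) by (intro mult_right_mono) auto
    finally have "t \<le> (weight c1 + weight c2) * n ^ ?e" .
    moreover have "1 + bcost b \<le> (1 + bcost b) * n ^ ?e"
      using mult_le_mono2[OF mono(3), of "1 + bcost b"] by simp
    ultimately show ?thesis by (simp add: algebra_simps)
  qed
  show ?thesis
  proof (cases "bval b m")
    case True
    then obtain t m' where "exec c1 m t m'" "t \<le> weight c1 * n ^ loop_depth c1" "Q m'"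
      using assms(2) by (auto simp: runs_def)
    then show ?thesis
      unfolding runs_def using exec.CondTrue[OF True] bound[of t c1] by fastforce
  next
    case False
    then obtain t m' where "exec c2 m t m'" "t \<le> weight c2 * n ^ loop_depth c2" "Q m'"
      using assms(3) by (auto simp: runs_def)
    then show ?thesis
      unfolding runs_def using exec.CondFalse[OF False] bound[of t c2] by fastforce
  qed
qed

text \<open>The invariant is indexed by the number of completed iterations, so induction on the
  remaining ones yields termination and the step count together.\<close>

lemma runs_While:
  assumes n: "n \<ge> 1" and k: "k \<le> 2 * n" and init: "I 0 m"
    and step: "\<And>i m. i < k \<Longrightarrow> I i m \<Longrightarrow> bval b m \<and> runs n c m (I (Suc i))"
    and stop: "\<And>m. I k m \<Longrightarrow> \<not> bval b m \<and> Q m"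
  shows "runs n (While b c) m Q"
proof -
  define T where "T = 1 + bcost b + weight c * n ^ loop_depth c"
  have "\<exists>t m'. exec (While b c) m t m' \<and> t \<le> l * T + (1 + bcost b) \<and> Q m'"
    if "I (k - l) m" "l \<le> k" for l m
    using that
  proof (induction l arbitrary: m)
    case 0
    then show ?case using stop exec.WhileFalse by fastforce
  next
    case (Suc l)
    then have "k - Suc l < k" "Suc (k - Suc l) = k - l" by auto
    then have b: "bval b m" and "runs n c m (I (k - l))"
      using step[of "k - Suc l" m] Suc.prems by auto
    then obtain t1 m1 where 1: "exec c m t1 m1" "t1 \<le> weight c * n ^ loop_depth c" "I (k - l) m1"
      by (auto simp: runs_def)
    then obtain t2 m2 where 2: "exec (While b c) m1 t2 m2" "t2 \<le> l * T + (1 + bcost b)" "Q m2"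
      using Suc.IH Suc.prems by fastforce
    have "1 + bcost b + t1 + t2 \<le> Suc l * T + (1 + bcost b)"
      using 1(2) 2(2) by (simp add: T_def)
    then show ?case using exec.WhileTrue[OF b 1(1) 2(1)] 2(3) by blast
  qed
  from this[of k m] init obtain t m' where t: "exec (While b c) m t m'" "t \<le> k * T + (1 + bcost b)" "Q m'"
    by (metis diff_self_eq_0 order_refl)
  let ?e = "Suc (loop_depth c)"
  have "t \<le> 2 * n * T + (1 + bcost b)"
    using t(2) mult_le_mono1[OF k, of T] by linarith
  also have "\<dots> = (1 + bcost b) * (2 * n + 1) + 2 * weight c * n ^ ?e"
    by (simp add: T_def algebra_simps)
  \<comment> \<open>The guard is evaluated once more than the body; \<open>n \<ge> 1\<close> absorbs
    this extra test.\<close>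
  also have "\<dots> \<le> (1 + bcost b) * (3 * n ^ ?e) + 3 * weight c * n ^ ?e"
  proof (intro add_mono mult_left_mono mult_right_mono)
    have "n \<le> n ^ ?e" using n by (simp add: Suc_le_eq)
    then show "2 * n + 1 \<le> 3 * n ^ ?e" using n by linarith
  qed auto
  also have "\<dots> = weight (While b c) * n ^ loop_depth (While b c)"
    by (simp add: algebra_simps)
  finally show ?thesis unfolding runs_def using t by blast
qed

section \<open>Program fragments\<close>

abbreviation nreg :: "nat \<Rightarrow> nexp" where
  "nreg v \<equiv> NLoad (NConst v)"

text \<open>
  The real registers lie behind the input; natural register \<open>1\<close> holds their base address.
\<close>

definition rreg :: "nat \<Rightarrow> rexp" where
  "rreg k = RLoad (NAdd (nreg 1) (NConst k))"

definition set_nreg :: "nat \<Rightarrow> nexp \<Rightarrow> com" where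
  "set_nreg v e = NStore (NConst v) e"

definition set_rreg :: "nat \<Rightarrow> rexp \<Rightarrow> com" where
  "set_rreg k e = RStore (NAdd (nreg 1) (NConst k)) e"

definition for_loop :: "nat \<Rightarrow> nexp \<Rightarrow> com \<Rightarrow> com" where
  "for_loop v b c = Seq (set_nreg v (NConst 0))
     (While (NLess (nreg v) b) (Seq c (set_nreg v (NAdd (nreg v) (NConst 1)))))"

definition sum_loop :: "nat \<Rightarrow> nat \<Rightarrow> rexp \<Rightarrow> com" where
  "sum_loop v k e = Seq (set_rreg k (RCast (NConst 0)))
     (for_loop v (nreg 0) (set_rreg k (RAdd (rreg k) e)))"

definition keep_max :: "nat \<Rightarrow> nat \<Rightarrow> nat \<Rightarrow> rexp \<Rightarrow> com" where
  "keep_max best idx src e = Cond (RLess (rreg best) e)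
     (Seq (set_rreg best e) (set_nreg idx (nreg src))) Skip"

lemma loop_depth_simps [simp]:
  "loop_depth (set_nreg v e) = 0"
  "loop_depth (set_rreg k f) = 0"
  "loop_depth (for_loop v e c) = Suc (loop_depth c)"
  "loop_depth (sum_loop v k f) = 1"
  "loop_depth (keep_max best idx src f) = 0"
  by (simp_all add: set_nreg_def set_rreg_def for_loop_def sum_loop_def keep_max_def)

section \<open>Derived expressions and running maxima\<close>

definition rnum :: "nat \<Rightarrow> rexp" where
  "rnum k = RCast (NConst k)"

definition rabs :: "rexp \<Rightarrow> rexp" where
  "rabs a = RSqrt (RMul a a)"

definition rmax :: "rexp \<Rightarrow> rexp \<Rightarrow> rexp" where
  "rmax a b = RDiv (RAdd (RAdd a b) (rabs (RSub a b))) (rnum 2)"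

text \<open>
  With \<open>s = a - b\<close>, the quotient of \<open>s + \<bar>s\<bar>\<close> by itself is \<open>0\<close> if \<open>s \<le> 0\<close> (division by zero) and
  \<open>1\<close> otherwise.
\<close>

definition rle :: "rexp \<Rightarrow> rexp \<Rightarrow> rexp" where
  "rle a b = (let s = RSub a b; t = RAdd s (rabs s) in RSub (rnum 1) (RDiv t t))"

text \<open>Naturals have no multiplication instruction; for fixed \<open>k\<close> the repeated
  addition has constant cost.\<close>

primrec nmul :: "nat \<Rightarrow> nexp \<Rightarrow> nexp" where
  "nmul 0 a = NConst 0"
| "nmul (Suc k) a = NAdd a (nmul k a)"

primrec rpow :: "nat \<Rightarrow> rexp \<Rightarrow> rexp" where
  "rpow 0 a = rnum 1"
| "rpow (Suc k) a = RMul a (rpow k a)"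

lemma rval_rnum [simp]: "rval (rnum k) m = real k"
  by (simp add: rnum_def)

lemma rval_rabs [simp]: "rval (rabs a) m = \<bar>rval a m\<bar>"
  by (simp add: rabs_def)

lemma rval_rmax [simp]: "rval (rmax a b) m = max (rval a m) (rval b m)"
  by (simp add: rmax_def max_def)

lemma rval_rle [simp]: "rval (rle a b) m = of_bool (rval a m \<le> rval b m)"
  by (cases "rval a m \<le> rval b m") (simp_all add: rle_def Let_def)

lemma nval_nmul [simp]: "nval (nmul k a) m = k * nval a m"
  by (induction k) auto

lemma rval_rpow [simp]: "rval (rpow k a) m = rval a m ^ k"
  by (induction k) auto

definition coord :: "nat \<Rightarrow> nexp \<Rightarrow> nat \<Rightarrow> rexp" where
  "coord d a k = RLoad (NAdd (nmul d a) (NConst k))"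

text \<open>The coordinates are unrolled inside one expression, so a distance costs constant time
  for fixed \<open>d\<close> and adds no loop depth.\<close>

primrec rdiff :: "nat \<Rightarrow> nat \<Rightarrow> nexp \<Rightarrow> nexp \<Rightarrow> rexp" where
  "rdiff d 0 a b = rnum 0"
| "rdiff d (Suc k) a b = rmax (rdiff d k a b) (rabs (RSub (coord d a k) (coord d b k)))"

primrec maxdiff :: "(nat \<Rightarrow> real) \<Rightarrow> nat \<Rightarrow> nat \<Rightarrow> nat \<Rightarrow> nat \<Rightarrow> real" where
  "maxdiff inp d 0 i j = 0"
| "maxdiff inp d (Suc k) i j = max (maxdiff inp d k i j) \<bar>inp (d * i + k) - inp (d * j + k)\<bar>"

lemma maxdiff_le_iff: "maxdiff inp d k i j \<le> h \<longleftrightarrow> 0 \<le> h \<and> (\<forall>l<k. \<bar>inp (d * i + l) - inp (d * j + l)\<bar> \<le> h)"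
  by (induction k) (auto simp: less_Suc_eq)

text \<open>The value 0 stands for "no positive weight so far"; only for a positive value does the
  index carry information.\<close>

definition is_max :: "'a set \<Rightarrow> ('a \<Rightarrow> real) \<Rightarrow> ('a \<Rightarrow> nat) \<Rightarrow> real \<Rightarrow> nat \<Rightarrow> bool" where
  "is_max S w ix val idx \<longleftrightarrow> 0 \<le> val \<and> (\<forall>s\<in>S. w s \<le> val) \<and> (0 < val \<longrightarrow> (\<exists>s\<in>S. w s = val \<and> ix s = idx))"

lemma is_max_empty: "is_max {} w ix 0 idx"
  by (simp add: is_max_def)

lemma is_max_insert:
  "is_max S w ix val idx \<Longrightarrow>
     is_max (insert s S) w ix (max val (w s)) (if val < w s then ix s else idx)"
  by (force simp: is_max_def max_def)

section \<open>Memory states and rules for loops\<close>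

locale machine =
  fixes n d :: nat and inp :: "nat \<Rightarrow> real"
  assumes n: "n \<ge> 1" and d: "d \<ge> 1"
begin

text \<open>The first \<open>d * n\<close> real cells are fixed to the input, so every state of this
  form keeps the points intact. Only writing the output leaves this form.\<close>

definition st :: "(nat \<Rightarrow> nat) \<Rightarrow> (nat \<Rightarrow> real) \<Rightarrow> mem" where
  "st N R = \<lparr>nmem = N, rmem = (\<lambda>a. if a < d * n then inp a else R (a - d * n))\<rparr>"

lemma nmem_st [simp]: "nmem (st N R) = N"
  by (simp add: st_def)

lemma rval_rreg [simp]: "N 1 = d * n \<Longrightarrow> rval (rreg k) (st N R) = R k"
  by (simp add: rreg_def st_def)

lemma rval_coord [simp]:
  assumes "nval a (st N R) < n" "k < d"
  shows "rval (coord d a k) (st N R) = inp (d * nval a (st N R) + k)"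
proof -
  have "d * nval a (st N R) + k < d * Suc (nval a (st N R))" using assms by simp
  also have "\<dots> \<le> d * n" using assms by (intro mult_le_mono2) auto
  finally show ?thesis by (simp add: coord_def) (simp add: st_def)
qed

lemma rval_rdiff [simp]:
  "nval a (st N R) < n \<Longrightarrow> nval b (st N R) < n \<Longrightarrow> k \<le> d \<Longrightarrow>
     rval (rdiff d k a b) (st N R) = maxdiff inp d k (nval a (st N R)) (nval b (st N R))"
  by (induction k) auto

lemma runs_set_nreg: "Q (st (N(v := nval e (st N R))) R) \<Longrightarrow> runs n (set_nreg v e) (st N R) Q"
  unfolding set_nreg_def by (rule runs_NStore) (simp add: st_def)

lemma runs_set_rreg:
  assumes "N 1 = d * n" "Q (st N (R(k := rval e (st N R))))"
  shows "runs n (set_rreg k e) (st N R) Q"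
proof -
  have "(st N R)\<lparr>rmem := (rmem (st N R))(d * n + k := x)\<rparr> = st N (R(k := x))" for x
    by (auto simp: st_def fun_eq_iff)
  then show ?thesis
    unfolding set_rreg_def using assms by (intro runs_RStore) simp
qed

text \<open>The loop bound is evaluated anew before each iteration, so \<open>ctr\<close> fixes its
  value, and the counter, in every state of the invariant.\<close>

lemma runs_for_loop:
  assumes k: "k \<le> 2 * n" and init: "I 0 (N(v := 0)) R"
    and step: "\<And>i N R. i < k \<Longrightarrow> I i N R \<Longrightarrow>
      runs n c (st N R) (\<lambda>m. \<exists>N' R'. m = st N' R' \<and> N' v = i \<and> I (Suc i) (N'(v := Suc i)) R')"
    and ctr: "\<And>i N R. I i N R \<Longrightarrow> N v = i \<and> nval b (st N R) = k"
    and post: "\<And>N R. I k N R \<Longrightarrow> Q (st N R)"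
  shows "runs n (for_loop v b c) (st N R) Q"
  unfolding for_loop_def
proof (intro runs_Seq[OF n] runs_set_nreg)
  show "runs n (While (NLess (nreg v) b) (Seq c (set_nreg v (NAdd (nreg v) (NConst 1)))))
     (st (N(v := nval (NConst 0) (st N R))) R) Q"
  proof (rule runs_While[OF n k, where I = "\<lambda>i m. \<exists>N R. m = st N R \<and> I i N R"])
    show "\<exists>N' R'. st (N(v := nval (NConst 0) (st N R))) R = st N' R' \<and> I 0 N' R'"
      using init by auto
  next
    fix i m assume i: "i < k" and "\<exists>N R. m = st N R \<and> I i N R"
    then obtain N R where m: "m = st N R" "I i N R" by blast
    have "runs n (Seq c (set_nreg v (NAdd (nreg v) (NConst 1)))) (st N R) (\<lambda>m. \<exists>N R. m = st N R \<and> I (Suc i) N R)"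
      by (rule runs_Seq[OF n runs_mono[OF step[OF i m(2)]]]) (auto intro!: runs_set_nreg, blast)
    then show "bval (NLess (nreg v) b) m \<and>
       runs n (Seq c (set_nreg v (NAdd (nreg v) (NConst 1)))) m (\<lambda>m. \<exists>N R. m = st N R \<and> I (Suc i) N R)"
      using ctr[OF m(2)] i m(1) by simp
  next
    fix m assume "\<exists>N R. m = st N R \<and> I k N R"
    then show "\<not> bval (NLess (nreg v) b) m \<and> Q m" using ctr post by fastforce
  qed
qed

text \<open>Quantifying over \<open>s\<close> in \<open>e\<close> makes the summand independent of
  the accumulator; \<open>v > 1\<close> protects the point count and the base address.\<close>

lemma runs_sum_loop:
  assumes "N 0 = n" "N 1 = d * n" "v > 1"
    and e: "\<And>x s. x < n \<Longrightarrow> rval e (st (N(v := x)) (R(k := s))) = f x"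
    and post: "Q (st (N(v := n)) (R(k := \<Sum>x<n. f x)))"
  shows "runs n (sum_loop v k e) (st N R) Q"
  unfolding sum_loop_def
proof (intro runs_Seq[OF n] runs_set_rreg assms(2))
  show "runs n (for_loop v (nreg 0) (set_rreg k (RAdd (rreg k) e)))
     (st N (R(k := rval (RCast (NConst 0)) (st N R)))) Q"
  proof (rule runs_for_loop[where k = n and I = "\<lambda>i N' R'. N' = N(v := i) \<and> R' = R(k := \<Sum>x<i. f x)"])
    fix i N' R' assume i: "i < n" and I: "N' = N(v := i) \<and> R' = R(k := \<Sum>x<i. f x)"
    show "runs n (set_rreg k (RAdd (rreg k) e)) (st N' R')
      (\<lambda>m. \<exists>N'' R''. m = st N'' R'' \<and> N'' v = i \<and> N''(v := Suc i) = N(v := Suc i) \<and> R'' = R(k := \<Sum>x<Suc i. f x))"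
      using I assms(2,3) e[OF i] by (intro runs_set_rreg) (auto intro!: exI[of _ N'])
  qed (use assms in auto)
qed

lemma runs_keep_max:
  assumes "rval e (st N R) = x" "N 1 = d * n" "idx > 1"
    and "Q (st (N(idx := if R best < x then N src else N idx)) (R(best := max (R best) x)))"
  shows "runs n (keep_max best idx src e) (st N R) Q"
  unfolding keep_max_def
proof (rule runs_Cond[OF n])
  assume "bval (RLess (rreg best) e) (st N R)"
  then show "runs n (Seq (set_rreg best e) (set_nreg idx (nreg src))) (st N R) Q"
    using assms by (intro runs_Seq[OF n] runs_set_rreg runs_set_nreg) (auto simp: max_def)
next
  assume "\<not> bval (RLess (rreg best) e) (st N R)"
  then show "runs n Skip (st N R) Q"
    using assms by (intro runs_Skip) (simp add: max_def)
qed

end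

section \<open>The separator program\<close>

definition min_count :: "nat \<Rightarrow> nat" where
  "min_count d = 4 ^ d + 1"

definition pdist :: "nat \<Rightarrow> nexp \<Rightarrow> nexp \<Rightarrow> rexp" where
  "pdist d a b = rdiff d d a b"

definition cell_mid :: "nexp \<Rightarrow> rexp" where
  "cell_mid j = RAdd (rnum 1) (RDiv (RAdd (RMul (rnum 2) (RCast j)) (rnum 1)) (RMul (rnum 4) (RCast (nreg 0))))"

text \<open>
  Natural registers: \<open>0\<close> number of points, \<open>1\<close> base address, \<open>2, 3, 4\<close> points, \<open>5\<close> best centre,
  \<open>6\<close> candidate root, \<open>7\<close> integer part of the \<open>d\<close>-th root, \<open>8\<close> grid index, \<open>9\<close> best grid index.
  Real registers: \<open>0\<close> inverse of the best radius, \<open>1\<close> accumulator, \<open>2\<close> inverse of the least total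
  charge, \<open>3\<close> half of the side length. Maximising inverses lets \<open>0\<close> play the role of infinity.
\<close>

definition find_centre :: "nat \<Rightarrow> com" where
  "find_centre d = Seq (set_rreg 0 (rnum 0)) (for_loop 2 (nreg 0) (for_loop 3 (nreg 0)
     (Seq (sum_loop 4 1 (rle (pdist d (nreg 4) (nreg 2)) (pdist d (nreg 3) (nreg 2))))
       (keep_max 0 5 2 (RMul (rle (RCast (nreg 0)) (RMul (rnum (min_count d)) (rreg 1)))
          (RDiv (rnum 1) (pdist d (nreg 3) (nreg 2))))))))"

text \<open>Without a floor operation the integer part is found by linear search; powers are formed
  in the reals, where multiplication exists.\<close>

definition find_root :: "nat \<Rightarrow> com" where
  "find_root d = Seq (set_nreg 7 (NConst 0)) (for_loop 6 (nreg 0)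
     (Cond (RLess (RCast (nreg 0)) (rpow d (RCast (NAdd (nreg 6) (NConst 1))))) Skip
       (set_nreg 7 (NAdd (nreg 6) (NConst 1)))))"

definition gap_exp :: "nat \<Rightarrow> rexp" where
  "gap_exp d = rabs (RSub (RMul (pdist d (nreg 4) (nreg 5)) (rreg 0)) (cell_mid (nreg 8)))"

definition charge_exp :: "nat \<Rightarrow> rexp" where
  "charge_exp d = (let u = gap_exp d; z = RSqrt (RSqrt (RMul (RCast (nreg 7)) u)) in
     RAdd (RDiv (rnum 1) (RMul (rpow 3 z) (rpow 2 (RAdd (rnum 1) z))))
       (RMul (RMul (rnum 33) (RCast (nreg 0))) (RSub (rnum 1) (RDiv u u))))"

definition find_grid_point :: "nat \<Rightarrow> com" where
  "find_grid_point d = Seq (set_rreg 2 (rnum 0)) (for_loop 8 (nmul 2 (nreg 0))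
     (Seq (sum_loop 4 1 (charge_exp d)) (keep_max 2 9 8 (RDiv (rnum 1) (rreg 1)))))"

definition set_half_side :: "nat \<Rightarrow> com" where
  "set_half_side d = Cond (NLess (NConst (min_count d)) (nreg 0))
     (set_rreg 3 (RDiv (cell_mid (nreg 9)) (rreg 0)))
     (set_rreg 3 (RDiv (RDiv (rnum 1) (rreg 0)) (rnum 2)))"

primrec write_corner :: "nat \<Rightarrow> nat \<Rightarrow> com" where
  "write_corner d 0 = Skip"
| "write_corner d (Suc k) = Seq (write_corner d k)
     (RStore (NConst k) (RSub (coord d (nreg 5) k) (rreg 3)))"

definition write_output :: "nat \<Rightarrow> com" where
  "write_output d = Seq (write_corner d d) (RStore (NConst d) (RMul (rnum 2) (rreg 3)))"

definition separator_program :: "nat \<Rightarrow> com" where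
  "separator_program d = Seq (set_nreg 1 (nmul d (nreg 0))) (Seq (find_centre d)
     (Seq (find_root d) (Seq (find_grid_point d) (Seq (set_half_side d) (write_output d)))))"

lemma loop_depth_write_corner [simp]: "loop_depth (write_corner d k) = 0"
  by (induction k) auto

lemma loop_depth_separator_program: "loop_depth (separator_program d) = 3"
  by (simp add: separator_program_def find_centre_def find_root_def find_grid_point_def
      set_half_side_def write_output_def)

section \<open>Effects of the phases of the program\<close>

context machine
begin

abbreviation dist_pts :: "nat \<Rightarrow> nat \<Rightarrow> real" where
  "dist_pts \<equiv> maxdiff inp d d"

text \<open>Pairs with equal entries get weight 1/0 = 0, just like uncrowded pairs, so no separate
  test excludes them.\<close>

definition centre_weight :: "nat \<times> nat \<Rightarrow> real" where
  "centre_weight = (\<lambda>(p, q).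
     of_bool (real n \<le> real (min_count d) * (\<Sum>x<n. of_bool (dist_pts x p \<le> dist_pts q p)))
       * (1 / dist_pts q p))"

lemma rval_pdist [simp]:
  "nval a (st N R) < n \<Longrightarrow> nval b (st N R) < n \<Longrightarrow>
     rval (pdist d a b) (st N R) = dist_pts (nval a (st N R)) (nval b (st N R))"
  by (simp add: pdist_def)

lemma rval_cell_mid [simp]:
  "N 0 = n \<Longrightarrow> rval (cell_mid j) (st N R) = 1 + (2 * real (nval j (st N R)) + 1) / (4 * real n)"
  by (simp add: cell_mid_def)

lemma runs_find_centre:
  assumes "N 0 = n" "N 1 = d * n"
    and post: "\<And>N R. N 0 = n \<Longrightarrow> N 1 = d * n \<Longrightarrow>
      is_max ({..<n} \<times> {..<n}) centre_weight fst (R 0) (N 5) \<Longrightarrow> Q (st N R)"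
  shows "runs n (find_centre d) (st N R) Q"
  unfolding find_centre_def
proof (intro runs_Seq[OF n] runs_set_rreg assms(2))
  define I where "I p N R \<longleftrightarrow> N 0 = n \<and> N 1 = d * n \<and> N 2 = p \<and>
    is_max ({..<p} \<times> {..<n}) centre_weight fst (R 0) (N 5)" for p and N :: "nat \<Rightarrow> nat" and R :: "nat \<Rightarrow> real"
  \<comment> \<open>The pairs treated so far form a prefix of the lexicographic order:
    \<open>p\<close> full rows and \<open>q\<close> entries of the next.\<close>
  define J where "J p q N R \<longleftrightarrow> N 0 = n \<and> N 1 = d * n \<and> N 2 = p \<and> N 3 = q \<and>
    is_max ({..<p} \<times> {..<n} \<union> {p} \<times> {..<q}) centre_weight fst (R 0) (N 5)"
    for p q and N :: "nat \<Rightarrow> nat" and R :: "nat \<Rightarrow> real"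
  show "runs n (for_loop 2 (nreg 0) (for_loop 3 (nreg 0)
     (Seq (sum_loop 4 1 (rle (pdist d (nreg 4) (nreg 2)) (pdist d (nreg 3) (nreg 2))))
       (keep_max 0 5 2 (RMul (rle (RCast (nreg 0)) (RMul (rnum (min_count d)) (rreg 1)))
          (RDiv (rnum 1) (pdist d (nreg 3) (nreg 2)))))))) (st N (R(0 := rval (rnum 0) (st N R)))) Q"
  proof (rule runs_for_loop[where I = I and k = n])
    fix p N R assume p: "p < n" and I: "I p N R"
    show "runs n (for_loop 3 (nreg 0)
       (Seq (sum_loop 4 1 (rle (pdist d (nreg 4) (nreg 2)) (pdist d (nreg 3) (nreg 2))))
         (keep_max 0 5 2 (RMul (rle (RCast (nreg 0)) (RMul (rnum (min_count d)) (rreg 1)))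
            (RDiv (rnum 1) (pdist d (nreg 3) (nreg 2))))))) (st N R)
       (\<lambda>m. \<exists>N' R'. m = st N' R' \<and> N' 2 = p \<and> I (Suc p) (N'(2 := Suc p)) R')"
    proof (rule runs_for_loop[where I = "J p" and k = n])
      fix q N R assume q: "q < n" and J: "J p q N R"
      let ?s = "\<Sum>x<n. of_bool (dist_pts x p \<le> dist_pts q p) :: real"
      let ?S = "{..<p} \<times> {..<n} \<union> {p} \<times> {..<q}"
      have S: "{..<p} \<times> {..<n} \<union> {p} \<times> {..<Suc q} = insert (p, q) ?S"
        by (auto simp: less_Suc_eq)
      show "runs n (Seq (sum_loop 4 1 (rle (pdist d (nreg 4) (nreg 2)) (pdist d (nreg 3) (nreg 2))))
         (keep_max 0 5 2 (RMul (rle (RCast (nreg 0)) (RMul (rnum (min_count d)) (rreg 1)))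
            (RDiv (rnum 1) (pdist d (nreg 3) (nreg 2)))))) (st N R)
         (\<lambda>m. \<exists>N' R'. m = st N' R' \<and> N' 3 = q \<and> J p (Suc q) (N'(3 := Suc q)) R')"
      proof (rule runs_Seq[OF n], rule runs_sum_loop[where f = "\<lambda>x. of_bool (dist_pts x p \<le> dist_pts q p)"])
        define N1 R1 where "N1 = N(4 := n)" and "R1 = R(1 := ?s)"
        let ?e = "RMul (rle (RCast (nreg 0)) (RMul (rnum (min_count d)) (rreg 1)))
            (RDiv (rnum 1) (pdist d (nreg 3) (nreg 2)))"
        have w: "rval ?e (st N1 R1) = centre_weight (p, q)"
          using J p q by (simp add: J_def N1_def R1_def centre_weight_def)
        have "is_max (insert (p, q) ?S) centre_weight fst (max (R 0) (centre_weight (p, q)))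
           (if R 0 < centre_weight (p, q) then p else N 5)"
          using J is_max_insert[of ?S centre_weight fst "R 0" "N 5" "(p, q)"] by (simp add: J_def cong: if_cong)
        then have "runs n (keep_max 0 5 2 ?e) (st N1 R1)
           (\<lambda>m. \<exists>N' R'. m = st N' R' \<and> N' 3 = q \<and> J p (Suc q) (N'(3 := Suc q)) R')"
          using J by - (rule runs_keep_max[OF w], simp add: N1_def J_def, simp,
            rule exI, rule exI, rule conjI, rule refl,
            simp add: J_def S N1_def R1_def cong: if_cong split del: if_split)
        then show "runs n (keep_max 0 5 2 ?e) (st (N(4 := n)) (R(1 := ?s)))
           (\<lambda>m. \<exists>N' R'. m = st N' R' \<and> N' 3 = q \<and> J p (Suc q) (N'(3 := Suc q)) R')"
          by (simp add: N1_def R1_def)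
      qed (use J p q in \<open>auto simp: J_def\<close>)
    next
      fix N R assume "J p n N R"
      moreover have "{..<Suc p} \<times> {..<n} = {..<p} \<times> {..<n} \<union> {p} \<times> {..<n}"
        by (auto simp: less_Suc_eq)
      ultimately show "\<exists>N' R'. st N R = st N' R' \<and> N' 2 = p \<and> I (Suc p) (N'(2 := Suc p)) R'"
        by (intro exI[of _ N] exI[of _ R]) (simp add: I_def J_def)
    qed (use I in \<open>auto simp: I_def J_def\<close>)
  qed (use assms is_max_empty in \<open>auto simp: I_def\<close>)
qed

lemma runs_find_root:
  assumes "N 0 = n" "N 1 = d * n"
    and post: "\<And>N'. N' 0 = n \<Longrightarrow> N' 1 = d * n \<Longrightarrow> N' 5 = N 5 \<Longrightarrow>
      0 < N' 7 \<Longrightarrow> N' 7 ^ d \<le> n \<Longrightarrow> n < (N' 7 + 1) ^ d \<Longrightarrow> Q (st N' R)"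
  shows "runs n (find_root d) (st N R) Q"
  unfolding find_root_def
proof (intro runs_Seq[OF n] runs_set_nreg)
  define I where "I i N' R' \<longleftrightarrow> R' = R \<and> N' 0 = n \<and> N' 1 = d * n \<and> N' 5 = N 5 \<and> N' 6 = i \<and>
    N' 7 ^ d \<le> n \<and> (\<forall>m\<le>i. m ^ d \<le> n \<longrightarrow> m \<le> N' 7)" for i and N' :: "nat \<Rightarrow> nat" and R' :: "nat \<Rightarrow> real"
  show "runs n (for_loop 6 (nreg 0) (Cond (RLess (RCast (nreg 0)) (rpow d (RCast (NAdd (nreg 6) (NConst 1))))) Skip
       (set_nreg 7 (NAdd (nreg 6) (NConst 1))))) (st (N(7 := nval (NConst 0) (st N R))) R) Q"
  proof (rule runs_for_loop[where I = I and k = n])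
    show "I 0 (N(7 := nval (NConst 0) (st N R), 6 := 0)) R"
      using assms d by (auto simp: I_def power_0_left)
  next
    fix i N1 R1 assume i: "i < n" and I: "I i N1 R1"
    have bv: "bval (RLess (RCast (nreg 0)) (rpow d (RCast (NAdd (nreg 6) (NConst 1))))) (st N1 R1) \<longleftrightarrow> n < Suc i ^ d"
      using I by (simp add: I_def flip: of_nat_power) (metis of_nat_Suc of_nat_less_iff of_nat_power)
    show "runs n (Cond (RLess (RCast (nreg 0)) (rpow d (RCast (NAdd (nreg 6) (NConst 1))))) Skip
       (set_nreg 7 (NAdd (nreg 6) (NConst 1)))) (st N1 R1)
       (\<lambda>m. \<exists>N' R'. m = st N' R' \<and> N' 6 = i \<and> I (Suc i) (N'(6 := Suc i)) R')"
    proof (rule runs_Cond[OF n], goal_cases)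
      case 1
      then show ?case
        unfolding bv using I by (intro runs_Skip exI[of _ N1] exI[of _ R1]) (auto simp: I_def le_Suc_eq)
    next
      case 2
      then show ?case
        unfolding bv using I
        by (intro runs_set_nreg exI[of _ "N1(7 := Suc i)"] exI[of _ R1]) (auto simp: I_def not_less)
    qed
  next
    fix N1 R1 assume I: "I n N1 R1"
    have "1 \<le> N1 7" using I n d by (auto simp: I_def)
    moreover have "n < (N1 7 + 1) ^ d"
    proof (rule ccontr)
      assume "\<not> ?thesis"
      then have *: "(N1 7 + 1) ^ d \<le> n" by simp
      \<comment> \<open>The invariant covers only candidates up to \<open>n\<close>; this brings the
        successor into that range.\<close>
      have "N1 7 + 1 \<le> (N1 7 + 1) ^ d"
        using d by (intro self_le_power) auto
      with * have "N1 7 + 1 \<le> n" by (rule order_trans[rotated])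
      with * I have "N1 7 + 1 \<le> N1 7" unfolding I_def by blast
      then show False by simp
    qed
    ultimately show "Q (st N1 R1)" using I post[of N1] by (auto simp: I_def)
  qed (auto simp: I_def)
qed

definition grid_weight :: "nat \<Rightarrow> real \<Rightarrow> nat \<Rightarrow> nat \<Rightarrow> real" where
  "grid_weight p w N j = 1 / (\<Sum>x<n. charge n N \<bar>dist_pts x p * w - grid n j\<bar>)"

lemma runs_find_grid_point:
  assumes "N 0 = n" "N 1 = d * n" "N 5 < n"
    and post: "\<And>N' R'. N' 0 = n \<Longrightarrow> N' 1 = d * n \<Longrightarrow> N' 5 = N 5 \<Longrightarrow> R' 0 = R 0 \<Longrightarrow>
      is_max {..<2 * n} (grid_weight (N 5) (R 0) (N 7)) id (R' 2) (N' 9) \<Longrightarrow> Q (st N' R')"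
  shows "runs n (find_grid_point d) (st N R) Q"
  unfolding find_grid_point_def
proof (intro runs_Seq[OF n] runs_set_rreg assms(2))
  define I where "I j N' R' \<longleftrightarrow> R' 0 = R 0 \<and> N' 0 = n \<and> N' 1 = d * n \<and> N' 5 = N 5 \<and> N' 7 = N 7 \<and> N' 8 = j \<and>
    is_max {..<j} (grid_weight (N 5) (R 0) (N 7)) id (R' 2) (N' 9)" for j and N' :: "nat \<Rightarrow> nat" and R' :: "nat \<Rightarrow> real"
  show "runs n (for_loop 8 (nmul 2 (nreg 0))
     (Seq (sum_loop 4 1 (charge_exp d)) (keep_max 2 9 8 (RDiv (rnum 1) (rreg 1)))))
     (st N (R(2 := rval (rnum 0) (st N R)))) Q"
  proof (rule runs_for_loop[where I = I and k = "2 * n"])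
    fix j N1 R1 assume j: "j < 2 * n" and I: "I j N1 R1"
    let ?f = "\<lambda>x. charge n (N 7) \<bar>dist_pts x (N 5) * R 0 - grid n j\<bar>"
    show "runs n (Seq (sum_loop 4 1 (charge_exp d)) (keep_max 2 9 8 (RDiv (rnum 1) (rreg 1)))) (st N1 R1)
       (\<lambda>m. \<exists>N' R'. m = st N' R' \<and> N' 8 = j \<and> I (Suc j) (N'(8 := Suc j)) R')"
    proof (rule runs_Seq[OF n], rule runs_sum_loop[where f = ?f])
      fix x s assume "x < n"
      then show "rval (charge_exp d) (st (N1(4 := x)) (R1(1 := s))) = ?f x"
        using I assms(3) by (simp add: I_def charge_exp_def gap_exp_def Let_def charge_def profile_def grid_def)
    next
      define N2 R2 where "N2 = N1(4 := n)" and "R2 = R1(1 := \<Sum>x<n. ?f x)"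
      have w: "rval (RDiv (rnum 1) (rreg 1)) (st N2 R2) = grid_weight (N 5) (R 0) (N 7) j"
        using I by (simp add: I_def N2_def R2_def grid_weight_def)
      have "is_max (insert j {..<j}) (grid_weight (N 5) (R 0) (N 7)) id (max (R1 2) (grid_weight (N 5) (R 0) (N 7) j))
          (if R1 2 < grid_weight (N 5) (R 0) (N 7) j then j else N1 9)"
        using I is_max_insert[of "{..<j}" "grid_weight (N 5) (R 0) (N 7)" id "R1 2" "N1 9" j] by (simp add: I_def cong: if_cong)
      then have "runs n (keep_max 2 9 8 (RDiv (rnum 1) (rreg 1))) (st N2 R2)
        (\<lambda>m. \<exists>N' R'. m = st N' R' \<and> N' 8 = j \<and> I (Suc j) (N'(8 := Suc j)) R')"
        using I by - (rule runs_keep_max[OF w], simp add: N2_def I_def, simp,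
            rule exI, rule exI, rule conjI, rule refl,
            simp add: I_def N2_def R2_def lessThan_Suc cong: if_cong split del: if_split)
      then show "runs n (keep_max 2 9 8 (RDiv (rnum 1) (rreg 1))) (st (N1(4 := n)) (R1(1 := \<Sum>x<n. ?f x)))
        (\<lambda>m. \<exists>N' R'. m = st N' R' \<and> N' 8 = j \<and> I (Suc j) (N'(8 := Suc j)) R')"
        by (simp add: N2_def R2_def)
    qed (use I in \<open>auto simp: I_def\<close>)
  qed (use assms is_max_empty in \<open>auto simp: I_def\<close>)
qed

lemma runs_set_half_side:
  assumes "N 0 = n" "N 1 = d * n"
    and "Q (st N (R(3 := if n > min_count d then grid n (N 9) / R 0 else 1 / R 0 / 2)))"
  shows "runs n (set_half_side d) (st N R) Q"
  unfolding set_half_side_def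
  by (rule runs_Cond[OF n]; rule runs_set_rreg) (use assms in \<open>auto simp: grid_def\<close>)

text \<open>
  Coordinate \<open>k\<close> of a point is stored at an address \<open>\<ge> k\<close>, so it is read before it is overwritten.
\<close>

lemma runs_write_corner:
  assumes "N 1 = d * n" "N 5 < n" "k \<le> d"
    and "Q ((st N R)\<lparr>rmem := \<lambda>a. if a < k then inp (d * N 5 + a) - R 3 else rmem (st N R) a\<rparr>)"
  shows "runs n (write_corner d k) (st N R) Q"
  using assms(3,4)
proof (induction k arbitrary: Q)
  case 0
  then show ?case by (simp add: runs_Skip)
next
  case (Suc k)
  have "d * N 5 + k < d * Suc (N 5)" using Suc.prems by simp
  also have "\<dots> \<le> d * n" using assms by (intro mult_le_mono2) auto
  finally have a: "d * N 5 + k < d * n" .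
  \<comment> \<open>The register with half the side length lies beyond the cells overwritten so
    far.\<close>
  then have stack: "\<not> d * n + 3 < k" by linarith
  show ?case
    unfolding write_corner.simps
  proof (rule runs_Seq[OF n], rule Suc.IH)
    show "runs n (RStore (NConst k) (RSub (coord d (nreg 5) k) (rreg 3)))
      ((st N R)\<lparr>rmem := \<lambda>a. if a < k then inp (d * N 5 + a) - R 3 else rmem (st N R) a\<rparr>) Q"
    proof (rule runs_RStore)
      let ?m = "(st N R)\<lparr>rmem := \<lambda>a. if a < k then inp (d * N 5 + a) - R 3 else rmem (st N R) a\<rparr>"
      have "rval (coord d (nreg 5) k) ?m = inp (d * N 5 + k)"
        using a by (simp add: coord_def) (simp add: st_def)
      moreover have "rval (rreg 3) ?m = R 3"
        using stack assms(1) by (simp add: rreg_def st_def)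
      ultimately have "(rmem ?m)(nval (NConst k) ?m := rval (RSub (coord d (nreg 5) k) (rreg 3)) ?m)
          = (\<lambda>a. if a < Suc k then inp (d * N 5 + a) - R 3 else rmem (st N R) a)"
        by (auto simp: fun_eq_iff less_Suc_eq)
      then show "Q (?m\<lparr>rmem := (rmem ?m)(nval (NConst k) ?m := rval (RSub (coord d (nreg 5) k) (rreg 3)) ?m)\<rparr>)"
        using Suc.prems(2) by simp
    qed
  qed (use Suc.prems in simp)
qed

lemma runs_write_output:
  assumes "N 1 = d * n" "N 5 < n" "n \<ge> 2"
    and "\<And>m. (\<And>k. k < d \<Longrightarrow> rmem m k = inp (d * N 5 + k) - R 3) \<Longrightarrow> rmem m d = 2 * R 3 \<Longrightarrow> Q m"
  shows "runs n (write_output d) (st N R) Q"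
  unfolding write_output_def
proof (rule runs_Seq[OF n], rule runs_write_corner[OF assms(1,2) order_refl], rule runs_RStore)
  let ?m = "(st N R)\<lparr>rmem := \<lambda>a. if a < d then inp (d * N 5 + a) - R 3 else rmem (st N R) a\<rparr>"
  have "d \<le> d * n" using n by simp
  then have "\<not> d * n + 3 < d" by linarith
  then have "rval (rreg 3) ?m = R 3"
    using assms(1) by (simp add: rreg_def st_def)
  then show "Q (?m\<lparr>rmem := (rmem ?m)(nval (NConst d) ?m := rval (RMul (rnum 2) (rreg 3)) ?m)\<rparr>)"
    by (intro assms(4)) auto
qed

end

section \<open>Correctness\<close>

lemma sum_nth_distinct:
  assumes "distinct xs"
  shows "(\<Sum>i<length xs. f (xs ! i)) = (\<Sum>x\<in>set xs. f x)"
  by (rule sum.reindex_bij_betw[OF bij_betw_nth[OF assms refl refl]])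

text \<open>Both numbers have the same upper bounds, because \<open>e\<close> reaches every
  coordinate.\<close>

lemma maxdiff_eq_infnorm:
  fixes a b :: "real ^ 'd::finite"
  assumes e: "bij_betw e {..<CARD('d)} UNIV"
    and inp: "\<And>k. k < CARD('d) \<Longrightarrow> inp (d * i + k) = a $ e k" "\<And>k. k < CARD('d) \<Longrightarrow> inp (d * j + k) = b $ e k"
  shows "maxdiff inp d CARD('d) i j = infnorm (a - b)"
proof -
  have "\<exists>l<CARD('d). e l = k" for k
    using e unfolding bij_betw_def by (metis UNIV_I imageE lessThan_iff)
  then have "(\<forall>l<CARD('d). A (e l)) \<longleftrightarrow> (\<forall>k. A k)" for A
    by metis
  from this[of "\<lambda>k. \<bar>a $ k - b $ k\<bar> \<le> h" for h]
  have "(\<forall>l<CARD('d). \<bar>a $ e l - b $ e l\<bar> \<le> h) \<longleftrightarrow> infnorm (a - b) \<le> h" for h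
    by (simp add: infnorm_le_iff)
  then have "maxdiff inp d CARD('d) i j \<le> h \<longleftrightarrow> infnorm (a - b) \<le> h" for h
    using infnorm_pos_le[of "a - b"] by (auto simp: maxdiff_le_iff inp)
  then show ?thesis by (metis order_antisym order_refl)
qed

lemma output_sep_eq_centred:
  fixes p :: "real ^ 'd::finite"
  assumes e: "bij_betw e {..<CARD('d)} UNIV"
    and m: "\<And>k. k < CARD('d) \<Longrightarrow> rmem m k = p $ e k - h" "rmem m CARD('d) = 2 * h"
  shows "output_sep e m = centred p h"
proof -
  have "rmem m (the_inv_into {..<CARD('d)} e k) = p $ k - h" for k
  proof -
    have "e (the_inv_into {..<CARD('d)} e k) = k"
      using e by (intro f_the_inv_into_f_bij_betw) auto
    moreover have "the_inv_into {..<CARD('d)} e k \<in> {..<CARD('d)}"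
      using e by (intro the_inv_into_into) (auto simp: bij_betw_def)
    ultimately show ?thesis using m(1)[of "the_inv_into {..<CARD('d)} e k"] by simp
  qed
  then show ?thesis by (simp add: output_sep_def centred_def m(2) vec_eq_iff)
qed

lemma separator_program_correct:
  fixes ps :: "(real ^ 'd::finite) list"
  assumes e: "bij_betw e {..<CARD('d)} UNIV" and dist: "distinct ps" and len: "length ps \<ge> 2"
    and C: "C \<ge> 4096" "C \<ge> 2 * (4 ^ CARD('d) + 1)"
  shows "runs (length ps) (separator_program CARD('d)) (input_mem e ps) (\<lambda>m. good_separator C (set ps) (output_sep e m))"
proof -
  define n d where "n = length ps" and "d = CARD('d)"
  define P where "P = set ps"
  define inp where "inp a = (ps ! (a div d)) $ e (a mod d)" for a
  have d0: "d > 0" by (simp add: d_def)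
  have n2: "n \<ge> 2" using len by (simp add: n_def)
  interpret machine n d inp
    by unfold_locales (use n2 d0 in auto)
  have finP: "finite P" and cardP: "card P = n"
    using dist by (auto simp: P_def n_def distinct_card)
  have inp: "inp (d * i + k) = (ps ! i) $ e k" if "k < d" for i k
    using that by (simp add: inp_def)
  have dist_pts: "dist_pts i j = infnorm (ps ! i - ps ! j)" for i j
    unfolding d_def by (rule maxdiff_eq_infnorm[OF e]) (use inp in \<open>auto simp: d_def\<close>)
  have input: "input_mem e ps = st (\<lambda>j. if j = 0 then n else 0) (\<lambda>_. 0)"
    unfolding input_mem_def st_def inp_def n_def[symmetric] d_def[symmetric]
    by (simp add: mult.commute fun_eq_iff)
  have nthP: "ps ! i \<in> P" if "i < n" for i
    using that by (simp add: P_def n_def)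
  have nth_neq: "ps ! i \<noteq> ps ! j" if "i < n" "j < n" "i \<noteq> j" for i j
    using that dist by (simp add: n_def nth_eq_iff_index_eq)
  have sum_nth: "(\<Sum>i<n. f (ps ! i)) = (\<Sum>x\<in>P. f x)" for f :: "_ \<Rightarrow> real"
    unfolding n_def P_def by (rule sum_nth_distinct[OF dist])
  have count: "(\<Sum>x<n. of_bool (dist_pts x i \<le> s)) = real (card {x \<in> P. infnorm (x - ps ! i) \<le> s})" for i s
  proof -
    have "(\<Sum>x<n. of_bool (dist_pts x i \<le> s)) = (\<Sum>x\<in>P. of_bool (infnorm (x - ps ! i) \<le> s) :: real)"
      unfolding dist_pts by (rule sum_nth)
    then show ?thesis using finP by (simp add: Int_def)
  qed
  have weight: "centre_weight (i, j) = of_bool (crowded P (ps ! i) (infnorm (ps ! j - ps ! i))) * (1 / infnorm (ps ! j - ps ! i))" for i j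
  proof -
    have "real n \<le> real (min_count d) * real k \<longleftrightarrow> n \<le> (4 ^ CARD('d) + 1) * k" for k
      unfolding min_count_def d_def of_nat_mult[symmetric] of_nat_le_iff ..
    then show ?thesis
      unfolding centre_weight_def crowded_def cardP by (simp only: count prod.case) (simp only: dist_pts)
  qed
  have centre: "0 < w \<and> i < n \<and> smallest_crowded P (ps ! i) (1 / w)"
    if mx: "is_max ({..<n} \<times> {..<n}) centre_weight fst w i" for w i
  proof -
    \<comment> \<open>The cube about the first point reaching its farthest point contains all of
      \<open>P\<close>. So some pair has positive weight, and the index of the maximum is
      meaningful.\<close>
    define s where "s = Max ((\<lambda>x. infnorm (x - ps ! 0)) ` P)"
    have "s \<in> (\<lambda>x. infnorm (x - ps ! 0)) ` P"
      unfolding s_def using finP nthP[of 0] n2 by (intro Max_in) auto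
    then obtain j where j: "j < n" "s = infnorm (ps ! j - ps ! 0)"
      by (auto simp: P_def n_def in_set_conv_nth)
    have s_ge: "infnorm (x - ps ! 0) \<le> s" if "x \<in> P" for x
      unfolding s_def using that finP by simp
    have "0 < infnorm (ps ! 1 - ps ! 0)"
      using nth_neq[of 1 0] n2 by (simp add: infnorm_pos_lt)
    also have "\<dots> \<le> s" using s_ge[OF nthP[of 1]] n2 by simp
    finally have s0: "0 < s" .
    have "{x \<in> P. infnorm (x - ps ! 0) \<le> s} = P" using s_ge by auto
    then have "crowded P (ps ! 0) s" by (simp add: crowded_def)
    then have "0 < centre_weight (0, j)" using s0 j by (simp add: weight)
    also have "\<dots> \<le> w" using mx j n2 by (auto simp: is_max_def)
    finally have w: "0 < w" .
    then obtain k where k: "i < n" "k < n" "centre_weight (i, k) = w"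
      using mx by (auto simp: is_max_def)
    have cr: "crowded P (ps ! i) (infnorm (ps ! k - ps ! i))"
      using w k(3) by (rule_tac ccontr) (simp add: weight)
    with k have r: "1 / w = infnorm (ps ! k - ps ! i)" by (auto simp: weight)
    have "1 / w \<le> infnorm (q' - p')"
      if pq: "p' \<in> P" "q' \<in> P" "p' \<noteq> q'" "crowded P p' (infnorm (q' - p'))" for p' q'
    proof -
      obtain a b where ab: "a < n" "b < n" "p' = ps ! a" "q' = ps ! b"
        using pq by (auto simp: P_def n_def in_set_conv_nth)
      have "centre_weight (a, b) \<le> w"
        using mx ab by (auto simp: is_max_def)
      then have "1 / infnorm (q' - p') \<le> w" using pq(4) ab by (simp add: weight)
      moreover have "0 < infnorm (q' - p')" using pq by (simp add: infnorm_pos_lt)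
      ultimately show ?thesis using w by (simp add: field_simps)
    qed
    moreover have "0 < 1 / w" using w by simp
    ultimately show ?thesis
      unfolding smallest_crowded_def using w k nthP cr[folded r] by blast
  qed
  have grid: "j < 2 * n \<and> (\<Sum>x\<in>P. charge n N \<bar>infnorm (x - ps ! i) / (1 / w) - grid n j\<bar>) \<le> 32 * real n / real N"
    if mx: "is_max {..<2 * n} (grid_weight i w N) id v j" and N: "N > 0" for i w N v j
  proof -
    define \<Phi> where "\<Phi> j = (\<Sum>x\<in>P. charge n N \<bar>infnorm (x - ps ! i) / (1 / w) - grid n j\<bar>)" for j
    have gw: "grid_weight i w N j = 1 / \<Phi> j" for j
      unfolding grid_weight_def \<Phi>_def dist_pts
      by (subst sum_nth[symmetric]) simp
    \<comment> \<open>Positivity makes maximising \<open>1 / \<Phi> j\<close> the same as minimising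
      \<open>\<Phi> j\<close>.\<close>
    have pos: "\<Phi> j > 0" for j
      unfolding \<Phi>_def using finP nthP[of 0] n2 N by (intro sum_pos charge_pos) auto
    obtain l where l: "l < 2 * n" "\<Phi> l \<le> 32 * real n / real N"
      using exists_light_grid_point[OF finP cardP _ N] n2 unfolding \<Phi>_def by fastforce
    have "1 / \<Phi> l \<le> v" using mx l by (auto simp: is_max_def gw)
    moreover have "0 < 1 / \<Phi> l" using pos[of l] by simp
    ultimately have "0 < v" by linarith
    then have j: "j < 2 * n" "1 / \<Phi> j = v" using mx by (auto simp: is_max_def gw)
    with \<open>1 / \<Phi> l \<le> v\<close> have "1 / \<Phi> l \<le> 1 / \<Phi> j" by simp
    then have "\<Phi> j \<le> \<Phi> l" using pos[of j] pos[of l] by (simp add: field_simps)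
    with l(2) j(1) show ?thesis by (simp add: \<Phi>_def)
  qed
  have "runs n (separator_program d) (st (\<lambda>j. if j = 0 then n else 0) (\<lambda>_. 0)) (\<lambda>m. good_separator C P (output_sep e m))"
    unfolding separator_program_def
  proof (rule runs_Seq[OF n], rule runs_set_nreg, rule runs_Seq[OF n], rule runs_find_centre, goal_cases)
    case (3 N1 R1)
    note N1 = 3
    define p where "p = ps ! N1 5"
    have i: "0 < R1 0" "N1 5 < n" and r: "smallest_crowded P p (1 / R1 0)"
      using centre[OF 3(3)] by (auto simp: p_def)
    show ?case
    proof (rule runs_Seq[OF n], rule runs_find_root, goal_cases)
      case (3 N2)
      note N2 = 3
      show ?case
      proof (rule runs_Seq[OF n], rule runs_find_grid_point, goal_cases)
        case (4 N3 R3)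
        note j = grid[OF 4(5) N2(4)]
        show ?case
        proof (rule runs_Seq[OF n], rule runs_set_half_side, goal_cases)
          case 3
          define h where "h = (if n > min_count d then grid n (N3 9) / R3 0 else 1 / R3 0 / 2)"
          have "good_separator C P (centred p h)"
          proof (cases "n > min_count d")
            case True
            then have "h = grid n (N3 9) * (1 / R1 0)" using 4 by (simp add: h_def)
            moreover have "good_separator C P (centred p (grid n (N3 9) * (1 / R1 0)))"
              using True r N2 j grid_bounds[of "N3 9" n] C(1)
              by (intro good_separator_many_points[OF finP, where N = "N2 7"])
                 (auto simp: cardP min_count_def p_def d_def)
            ultimately show ?thesis by simp
          next
            case False
            then have "h = 1 / R1 0 / 2" using 4 by (simp add: h_def)
            moreover have "good_separator C P (centred p (1 / R1 0 / 2))"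
              using False r C(2) n2
              by (intro good_separator_few_points[OF finP])
                 (auto simp: cardP min_count_def d_def)
            ultimately show ?thesis by simp
          qed
          moreover have "output_sep e m = centred p h"
            if "\<And>k. k < d \<Longrightarrow> rmem m k = inp (d * N3 5 + k) - h" "rmem m d = 2 * h" for m
            using that 4(3) N2(3) by (intro output_sep_eq_centred[OF e]) (auto simp: d_def[symmetric] inp p_def)
          ultimately show ?case
            unfolding h_def[symmetric]
            using 4 N2 i n2 by (intro runs_write_output) auto
        qed (use 4 in auto)
      qed (use N2 i in auto)
    qed (use N1 in auto)
  qed auto
  then show ?thesis by (simp only: input n_def[symmetric] d_def[symmetric] P_def[symmetric])
qed

theorem theorem1:
  assumes "CARD('d::finite) \<ge> 2"
  shows "\<exists>C>0.
    (\<forall>P :: (real ^ 'd) set. finite P \<and> card P \<ge> 2 \<longrightarrow> (\<exists>\<sigma>. good_separator C P \<sigma>)) \<and>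
    (\<exists>c T. finds_good_separator TYPE('d) C c T \<and>
           (\<lambda>n. real (T n)) \<in> O(\<lambda>n. real n ^ (CARD('d) + 1)))"
proof -
  \<comment> \<open>The two entries serve the cases of many and of few points.\<close>
  define C where "C = max 4096 (2 * ((4::real) ^ CARD('d) + 1))"
  define c where "c = separator_program CARD('d)"
  define T where "T n = weight c * n ^ 3" for n
  have C: "C \<ge> 4096" "C \<ge> 2 * (4 ^ CARD('d) + 1)" by (simp_all add: C_def)
  have finds: "finds_good_separator TYPE('d) C c T"
    unfolding finds_good_separator_def
    using separator_program_correct[OF _ _ _ C]
    by (fastforce simp: runs_def c_def T_def loop_depth_separator_program)
  \<comment> \<open>Existence is read off from the algorithm, run on any enumeration of
    \<open>P\<close> and of the coordinates.\<close>
  have exists: "\<exists>\<sigma>. good_separator C P \<sigma>" if "finite P" "card P \<ge> 2" for P :: "(real ^ 'd) set"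
  proof -
    obtain ps where ps: "set ps = P" "distinct ps"
      using finite_distinct_list[OF \<open>finite P\<close>] by blast
    have "length ps = card P" using ps by (metis distinct_card)
    moreover obtain e :: "nat \<Rightarrow> 'd" where "bij_betw e {..<CARD('d)} UNIV"
      using ex_bij_betw_nat_finite[of "UNIV :: 'd set"] by (auto simp: atLeast0LessThan)
    ultimately show ?thesis
      using finds ps that(2) unfolding finds_good_separator_def by metis
  qed
  have "(\<lambda>n. real (T n)) \<in> O(\<lambda>n. real n ^ (CARD('d) + 1))"
  proof (rule bigoI[where c = "real (weight c)"])
    show "\<forall>\<^sub>F n in sequentially. norm (real (T n)) \<le> real (weight c) * norm (real n ^ (CARD('d) + 1))"
      using eventually_ge_at_top[of 1]
    proof eventually_elim
      case (elim n)
      \<comment> \<open>The loops are nested three deep, and \<open>d \<ge> 2\<close> gives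
        \<open>3 \<le> d + 1\<close>.\<close>
      then have "real n ^ 3 \<le> real n ^ (CARD('d) + 1)"
        using assms by (intro power_increasing) auto
      then show ?case by (simp add: T_def mult_left_mono)
    qed
  qed
  moreover have "C > 0" using C(1) by linarith
  ultimately show ?thesis using finds exists by blast
qed

end
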